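(* Let $n\ge 3$, let $p\in(1,\infty]$ and let $q\in[1,\infty)$ be the conjugate exponent of $p$, i.e. $\frac1p+\frac1q=1$ (with $q=1$ and $\frac{n-1}{p}=0$ if $p=\infty$). If $\phi\in L^{p}(\mathbb{S}^{n-1},\mathbb{R}^{n})$ and $u=P_{h}[\phi]$, then for every $x\in\mathbb{B}^{n}$, $$ |u(x)|\leq \frac{\mathbf{C}_{q}^{1/q}}{(1-|x|^2)^{\frac{n-1}{p}}}\,\|\phi\|_{L^{p}}, $$ where $$ \mathbf{C}_{q}={}_{2}F_{1}\left(-(n-1)(q-1),\ \tfrac{n}{2}+q-nq;\ \tfrac{n}{2};\ 1\right). $$ Moreover, the inequality is sharp: $\mathbf{C}_{q}^{1/q}$ is the smallest constant $K$ such that $|P_h[\phi](x)|\le K(1-|x|^2)^{-\frac{n-1}{p}}\|\phi\|_{L^p}$ for all $x\in\mathbb{B}^n$ and all $\phi\in L^{p}(\mathbb{S}^{n-1},\mathbb{R}^{n})$.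
   Context: $\mathbb{B}^{n}=\{x\in\mathbb{R}^{n}:|x|<1\}$ and $\mathbb{S}^{n-1}=\{x\in\mathbb{R}^{n}:|x|=1\}$, with $|\cdot|$ the Euclidean norm. $\sigma$ is the surface measure on $\mathbb{S}^{n-1}$ normalized so that $\sigma(\mathbb{S}^{n-1})=1$. $L^p(\mathbb{S}^{n-1},\mathbb{R}^n)$ is taken with respect to $\sigma$, with $\|\phi\|_{L^p}=\left(\int_{\mathbb{S}^{n-1}}|\phi|^p\,d\sigma\right)^{1/p}$ for $p<\infty$ and $\|\phi\|_{L^\infty}=\operatorname{ess\,sup}|\phi|$. For $\phi\in L^{1}(\mathbb{S}^{n-1},\mathbb{R}^{n})$, the invariant Poisson (Poisson-Szegö) integral of $\phi$ is $$P_{h}[\phi](x)=\int_{\mathbb{S}^{n-1}}P_{h}(x,\zeta)\phi(\zeta)\,d\sigma(\zeta),\quad x\in\mathbb{B}^n,\qquad P_{h}(x,\zeta)=\left(\frac{1-|x|^2}{|x-\zeta|^{2}}\right)^{n-1}.$$ The Gauss hypergeometric series is ${}_{2}F_{1}(a,b;c;t)=\sum_{k=0}^{\infty}\frac{(a)_{k}(b)_{k}}{k!\,(c)_{k}}t^{k}$, where $(a)_{0}=1$, $(a)_{k}=a(a+1)\cdots(a+k-1)$, and $c$ is neither zero nor a negative integer; it converges absolutely for all $|t|\le 1$ when $c-a-b>0$. *)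

theory Defs
  imports "HOL-Analysis.Analysis" "HOL-Probability.Essential_Supremum"
begin

text \<open>
  Normalized surface measure on the unit sphere, as the image of the uniform distribution on the
  unit ball under the radial projection \<open>x \<mapsto> x / |x|\<close> (polar coordinates). Lemma
  \<open>emeasure_sphere_measure\<close> gives the cone formula
  \<open>\<sigma>(A) = vol {t\<zeta> | 0 < t < 1, \<zeta> \<in> A} / vol B\<close>, and lemma \<open>prob_sphere_measure\<close> the normalization.
  Here \<open>sgn 0 = 0\<close> is outside the sphere, but \<open>{0}\<close> is a null set; the
  restriction makes the unit sphere the space of the measure.
\<close>
definition sphere_measure :: "'a::euclidean_space measure"
  where "sphere_measure =
    restrict_space (distr (uniform_measure lborel (ball 0 1)) borel sgn) (sphere 0 1)"

lemma space_sphere_measure: "space sphere_measure = sphere (0::'a::euclidean_space) 1"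
  by (simp add: sphere_measure_def space_restrict_space)

lemma sets_sphere_measure:
  "sets sphere_measure = sets (restrict_space borel (sphere (0::'a::euclidean_space) 1))"
  by (simp add: sphere_measure_def sets_restrict_space)

lemma emeasure_sphere_measure:
  fixes A :: "'a::euclidean_space set"
  assumes "A \<in> sets sphere_measure"
  shows "emeasure sphere_measure A =
    emeasure lborel {t *\<^sub>R z | t z. 0 < t \<and> t < 1 \<and> z \<in> A} / emeasure lborel (ball (0::'a) 1)"
proof -
  have sph: "sphere (0::'a) 1 \<in> sets borel"
    by simp
  have A: "A \<subseteq> sphere 0 1" "A \<in> sets borel"
    using assms sph by (auto simp: sets_sphere_measure sets_restrict_space)
  have [measurable]: "(sgn :: 'a \<Rightarrow> 'a) \<in> borel_measurable borel"
    unfolding sgn_div_norm by measurable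
  have cone: "ball 0 1 \<inter> sgn -` A = {t *\<^sub>R z | t z. 0 < t \<and> t < 1 \<and> z \<in> A}"
  proof (intro equalityI subsetI)
    fix x assume x: "x \<in> ball 0 1 \<inter> sgn -` A"
    with A(1) have "norm (sgn x) = 1" by auto
    then have "x \<noteq> 0" by auto
    then have "x = norm x *\<^sub>R sgn x" "0 < norm x" by (auto simp: sgn_div_norm)
    then show "x \<in> {t *\<^sub>R z | t z. 0 < t \<and> t < 1 \<and> z \<in> A}"
      using x by (intro CollectI exI[of _ "norm x"] exI[of _ "sgn x"]) auto
  next
    fix x assume "x \<in> {t *\<^sub>R z | t z. 0 < t \<and> t < 1 \<and> z \<in> A}"
    then obtain t z where tz: "x = t *\<^sub>R z" "0 < t" "t < 1" "z \<in> A" by auto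
    with A(1) have "norm z = 1" by auto
    with tz show "x \<in> ball 0 1 \<inter> sgn -` A" by (simp add: sgn_div_norm)
  qed
  have "emeasure sphere_measure A =
      emeasure (distr (uniform_measure lborel (ball 0 1)) borel sgn) A"
    unfolding sphere_measure_def using A sph by (intro emeasure_restrict_space) auto
  also have "\<dots> = emeasure (uniform_measure lborel (ball 0 1)) (sgn -` A)"
    using A(2) by (subst emeasure_distr) auto
  also have "\<dots> = emeasure lborel (ball 0 1 \<inter> sgn -` A) / emeasure lborel (ball (0::'a) 1)"
    using measurable_sets[of "sgn :: 'a \<Rightarrow> 'a" borel borel A] A(2)
    by (intro emeasure_uniform_measure) auto
  finally show ?thesis by (simp only: cone)
qed

lemma prob_sphere_measure:
  "emeasure sphere_measure (sphere (0::'a::euclidean_space) 1) = 1"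
proof -
  have "emeasure sphere_measure (sphere (0::'a) 1) =
    emeasure lborel {t *\<^sub>R z | t z. 0 < t \<and> t < 1 \<and> z \<in> sphere (0::'a) 1} /
    emeasure lborel (ball (0::'a) 1)"
    by (intro emeasure_sphere_measure) (simp add: sets_sphere_measure sets_restrict_space image_iff, force)
  also have "{t *\<^sub>R z | t z. 0 < t \<and> t < 1 \<and> z \<in> sphere (0::'a) 1} = ball 0 1 - {0}"
  proof (intro equalityI subsetI)
    fix x :: 'a assume x: "x \<in> ball 0 1 - {0}"
    then have "x = norm x *\<^sub>R sgn x" "0 < norm x" "norm (sgn x) = 1"
      by (auto simp: sgn_div_norm)
    then show "x \<in> {t *\<^sub>R z | t z. 0 < t \<and> t < 1 \<and> z \<in> sphere 0 1}"
      using x by (intro CollectI exI[of _ "norm x"] exI[of _ "sgn x"]) auto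
  qed auto
  also have "emeasure lborel (ball (0::'a) 1 - {0}) = emeasure lborel (ball (0::'a) 1)"
    by (subst emeasure_Diff) auto
  also have "\<dots> / emeasure lborel (ball (0::'a) 1) = 1"
  proof -
    have "emeasure lborel (ball (0::'a) 1) \<noteq> 0"
      using content_ball_pos[of 1 "0::'a"] by (auto simp: measure_def)
    moreover have "emeasure lborel (ball (0::'a) 1) \<noteq> \<infinity>"
      using emeasure_lborel_ball_finite[of "0::'a" 1] by simp
    ultimately show ?thesis
      by (metis ennreal_divide_self less_top infinity_ennreal_def)
  qed
  finally show ?thesis .
qed

text \<open>The exponent ranges over \<open>[1, \<infinity>]\<close>; functions are not identified almost everywhere.\<close>
definition Lp_space :: "ennreal \<Rightarrow> 'a measure \<Rightarrow> ('a \<Rightarrow> 'b::euclidean_space) set"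
  where "Lp_space p M = {f \<in> borel_measurable M.
    if p = \<infinity> then esssup M (\<lambda>x. ennreal (norm (f x))) < \<infinity>
    else integrable M (\<lambda>x. norm (f x) powr enn2real p)}"

definition Lp_norm :: "ennreal \<Rightarrow> 'a measure \<Rightarrow> ('a \<Rightarrow> 'b::euclidean_space) \<Rightarrow> real"
  where "Lp_norm p M f =
    (if p = \<infinity> then enn2real (esssup M (\<lambda>x. ennreal (norm (f x))))
     else (\<integral>x. norm (f x) powr enn2real p \<partial>M) powr (1 / enn2real p))"

definition poisson_szego_kernel :: "real ^ 'n \<Rightarrow> real ^ 'n \<Rightarrow> real"
  where "poisson_szego_kernel x z =
    ((1 - (norm x)\<^sup>2) / (norm (x - z))\<^sup>2) ^ (CARD('n) - 1)"

definition poisson_szego :: "(real ^ 'n \<Rightarrow> real ^ 'n) \<Rightarrow> real ^ 'n \<Rightarrow> real ^ 'n"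
  where "poisson_szego \<phi> x = (\<integral>z. poisson_szego_kernel x z *\<^sub>R \<phi> z \<partial>sphere_measure)"

definition hypergeo_2F1 :: "real \<Rightarrow> real \<Rightarrow> real \<Rightarrow> real \<Rightarrow> real"
  where "hypergeo_2F1 a b c t =
    (\<Sum>k. pochhammer a k * pochhammer b k / (fact k * pochhammer c k) * t ^ k)"

lemma hypergeo_2F1_eq_eval_fps:
  "hypergeo_2F1 a b c t = eval_fps (fps_hypergeo [a, b] [c] 1) t"
  by (simp add: hypergeo_2F1_def eval_fps_def mult_ac)

definition sharp_const :: "nat \<Rightarrow> real \<Rightarrow> real"
  where "sharp_const n q =
    hypergeo_2F1 (- (real n - 1) * (q - 1)) (real n / 2 + q - real n * q) (real n / 2) 1"

end

theory Submission
  imports Defs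
begin

text \<open>
  By duality the best constant at \<open>x\<close> is the \<open>L\<^sup>q\<close> norm of the kernel \<open>P(x, \<cdot>)\<close>. With
  \<open>\<alpha> = (n - 1) q\<close> and \<open>r = |x|\<close>, the \<open>q\<close>-th power of this norm is \<open>(1 - r\<^sup>2)\<close> to the power
  \<open>-(n - 1)(q - 1)\<close> times
  \<open>\<Psi>(r) = (1 - r\<^sup>2) powr (2\<alpha> - n + 1) * G(-\<alpha>, r)\<close>, where \<open>G(g, r)\<close> is the mean of
  \<open>|r e - \<zeta>| powr (2g)\<close> over the sphere. Invariance of \<open>\<sigma>\<close> under rotations in the planes through \<open>e\<close>
  gives an integration by parts for zonal functions, hence a contiguous relation between
  \<open>G(g - 2)\<close>, \<open>G(g - 1)\<close> and \<open>G(g)\<close>. Together with the formula for \<open>\<partial>G/\<partial>r\<close> it shows that \<open>\<Psi>\<close>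
  solves the hypergeometric equation in \<open>t = r\<^sup>2\<close>. In self-adjoint form, the equation and the
  positivity of \<open>\<Psi>\<close> imply that \<open>\<Psi>\<close> is increasing, and a Wronskian argument identifies \<open>\<Psi>\<close> with the
  series \<open>2F1\<close>. So the supremum of \<open>\<Psi>\<close> is the value of the series at \<open>1\<close>.
\<close>

subsection \<open>Rotation invariance of the surface measure\<close>

text \<open>Uniqueness of translation-invariant measures: by Fubini, \<open>\<lambda>(A) \<lambda>(f -` B) = \<lambda>(B) \<lambda>(f -` A)\<close>, and for
  the unit ball \<open>B\<close> the preimage is \<open>B\<close>.\<close>

lemma distr_lborel_orthogonal_transformation:
  fixes f :: "'a::euclidean_space \<Rightarrow> 'a"
  assumes f: "orthogonal_transformation f"
  shows "distr lborel borel f = lborel"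
proof (rule measure_eqI)
  have lin: "linear f" and nrm: "\<And>x. norm (f x) = norm x"
    using f by (simp_all add: orthogonal_transformation)
  have surj: "\<And>x. f (inv f x) = x"
    using orthogonal_transformation_surj[OF f] by (rule surj_f_inv_f)
  have [measurable]: "f \<in> borel_measurable borel"
    using lin by (simp add: borel_measurable_continuous_onI linear_continuous_on linear_linear)
  have reflect: "(\<integral>\<^sup>+x. g x \<partial>lborel) = (\<integral>\<^sup>+x. g (y - x) \<partial>lborel)"
    if [measurable]: "g \<in> borel_measurable borel" for g :: "'a \<Rightarrow> ennreal" and y
  proof -
    have "(lborel :: 'a measure) = distr lborel borel (\<lambda>x. y - x)"
      using lborel_affine[of "-1" y] by (simp add: density_1)
    then have "(\<integral>\<^sup>+x. g x \<partial>lborel) = (\<integral>\<^sup>+x. g x \<partial>distr lborel borel (\<lambda>x. y - x))"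
      by (rule arg_cong)
    also have "\<dots> = (\<integral>\<^sup>+x. g (y - x) \<partial>lborel)"
      by (rule nn_integral_distr) auto
    finally show ?thesis .
  qed
  have translate: "(\<integral>\<^sup>+y. g (f y) \<partial>lborel) = (\<integral>\<^sup>+y. g (f y - x) \<partial>lborel)"
    if [measurable]: "g \<in> borel_measurable borel" for g :: "'a \<Rightarrow> ennreal" and x
  proof -
    have "(\<integral>\<^sup>+y. g (f y) \<partial>lborel) = (\<integral>\<^sup>+y. g (f y) \<partial>distr lborel borel ((+) (- inv f x)))"
      by (simp add: lborel_distr_plus)
    also have "\<dots> = (\<integral>\<^sup>+y. g (f (- inv f x + y)) \<partial>lborel)"
      by (rule nn_integral_distr) auto
    also have "\<dots> = (\<integral>\<^sup>+y. g (f y - x) \<partial>lborel)"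
      using lin by (simp add: linear_diff surj)
    finally show ?thesis .
  qed
  \<comment> \<open>Shifting \<open>y\<close> by \<open>inv f x\<close> replaces \<open>f y\<close>
    by \<open>f y - x\<close> in the indicator of \<open>B\<close>; the reflection of
    \<open>x\<close> to \<open>f y - x\<close> moves the shift to \<open>A\<close>, and a second
    translation removes it. The roles of \<open>A\<close> and \<open>B\<close> are then
    exchanged.\<close>
  have swap: "emeasure lborel A * emeasure lborel (f -` B) = emeasure lborel B * emeasure lborel (f -` A)"
    if [measurable]: "A \<in> sets borel" "B \<in> sets borel" for A B
  proof -
    have vim: "emeasure lborel (f -` C) = (\<integral>\<^sup>+y. indicator C (f y) \<partial>lborel)"
      if [measurable]: "C \<in> sets borel" for C
    proof -
      have "(\<lambda>y. indicator C (f y)) = (indicator (f -` C) :: 'a \<Rightarrow> ennreal)"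
        by (auto split: split_indicator)
      moreover have "f -` C \<in> sets lborel"
        using measurable_sets[of f borel borel C] by simp
      ultimately show ?thesis
        by simp
    qed
    have "emeasure lborel A * emeasure lborel (f -` B)
        = (\<integral>\<^sup>+x. indicator A x * (\<integral>\<^sup>+y. indicator B (f y) \<partial>lborel) \<partial>lborel)"
      by (simp add: nn_integral_multc vim)
    also have "\<dots> = (\<integral>\<^sup>+x. \<integral>\<^sup>+y. indicator A x * indicator B (f y - x) \<partial>lborel \<partial>lborel)"
    proof (rule nn_integral_cong)
      fix x
      show "indicator A x * (\<integral>\<^sup>+y. indicator B (f y) \<partial>lborel) = (\<integral>\<^sup>+y. indicator A x * indicator B (f y - x) \<partial>lborel)"
        using translate[of "indicator B" x] by (simp add: nn_integral_cmult)
    qed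
    also have "\<dots> = (\<integral>\<^sup>+y. \<integral>\<^sup>+x. indicator A x * indicator B (f y - x) \<partial>lborel \<partial>lborel)"
      by (rule lborel_pair.Fubini'[symmetric]) measurable
    also have "\<dots> = (\<integral>\<^sup>+y. \<integral>\<^sup>+x. indicator A (f y - x) * indicator B x \<partial>lborel \<partial>lborel)"
    proof (rule nn_integral_cong)
      fix y
      show "(\<integral>\<^sup>+x. indicator A x * indicator B (f y - x) \<partial>lborel) = (\<integral>\<^sup>+x. indicator A (f y - x) * indicator B x \<partial>lborel)"
        using reflect[of "\<lambda>x. indicator A x * indicator B (f y - x)" "f y"] by simp
    qed
    also have "\<dots> = (\<integral>\<^sup>+x. \<integral>\<^sup>+y. indicator A (f y - x) * indicator B x \<partial>lborel \<partial>lborel)"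
      by (rule lborel_pair.Fubini') measurable
    also have "\<dots> = (\<integral>\<^sup>+x. (\<integral>\<^sup>+y. indicator A (f y) \<partial>lborel) * indicator B x \<partial>lborel)"
    proof (rule nn_integral_cong)
      fix x
      show "(\<integral>\<^sup>+y. indicator A (f y - x) * indicator B x \<partial>lborel) = (\<integral>\<^sup>+y. indicator A (f y) \<partial>lborel) * indicator B x"
        using translate[of "indicator A" x] by (simp add: nn_integral_multc)
    qed
    also have "\<dots> = emeasure lborel B * emeasure lborel (f -` A)"
      by (subst nn_integral_cmult_indicator) (simp_all add: vim mult.commute)
    finally show ?thesis .
  qed
  fix A assume "A \<in> sets (distr lborel borel f)"
  then have A: "A \<in> sets borel" by simp
  have "f -` ball 0 1 = ball 0 1"
    by (auto simp: nrm)
  then have "emeasure lborel (ball (0::'a) 1) * emeasure lborel A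
      = emeasure lborel (ball (0::'a) 1) * emeasure lborel (f -` A)"
    using swap[OF A, of "ball 0 1"] by (simp add: mult.commute[of "emeasure lborel A"])
  moreover have "emeasure lborel (ball (0::'a) 1) \<noteq> 0"
    using content_ball_pos[of 1 "0::'a"] by (auto simp: measure_def)
  moreover have "emeasure lborel (ball (0::'a) 1) \<noteq> \<infinity>"
    using emeasure_lborel_ball_finite[of "0::'a" 1] by simp
  ultimately have "emeasure lborel (f -` A) = emeasure lborel A"
    by (simp add: ennreal_mult_cancel_left)
  then show "emeasure (distr lborel borel f) A = emeasure lborel A"
    using A by (simp add: emeasure_distr)
qed simp

lemma borel_measurable_sphere_measure [measurable_dest, measurable (raw)]:
  "f \<in> borel_measurable borel \<Longrightarrow> f \<in> borel_measurable sphere_measure"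
  unfolding sphere_measure_def by (rule measurable_restrict_space1) simp

lemma finite_measure_sphere_measure: "finite_measure (sphere_measure :: 'a::euclidean_space measure)"
  by (rule finite_measureI) (simp add: space_sphere_measure prob_sphere_measure)

text \<open>The preimage under \<open>f\<close> of the cone over \<open>A\<close> is the cone over
  the preimage of \<open>A\<close>, so the cone formula reduces the claim to the invariance of
  \<open>lborel\<close>.\<close>

lemma distr_sphere_measure_orthogonal_transformation:
  fixes f :: "'a::euclidean_space \<Rightarrow> 'a::euclidean_space"
  assumes f: "orthogonal_transformation f"
  shows "distr sphere_measure sphere_measure f = sphere_measure"
proof (rule measure_eqI)
  have lin: "linear f" and nrm: "\<And>x. norm (f x) = norm x"
    using f by (simp_all add: orthogonal_transformation)
  have fb [measurable]: "f \<in> borel_measurable borel"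
    using lin by (simp add: borel_measurable_continuous_onI linear_continuous_on linear_linear)
  have [measurable]: "f \<in> measurable sphere_measure sphere_measure"
    unfolding measurable_cong_sets[OF sets_sphere_measure sets_sphere_measure]
    by (rule measurable_restrict_space3) (auto simp: nrm)
  fix A :: "'a set" assume "A \<in> sets (distr sphere_measure sphere_measure f)"
  then have A [measurable]: "A \<in> sets sphere_measure" by simp
  have A': "A \<subseteq> sphere 0 1"
    using sets.sets_into_space[OF A] by (simp add: space_sphere_measure)
  let ?cone = "\<lambda>A :: 'a set. {t *\<^sub>R z | t z. 0 < t \<and> t < 1 \<and> z \<in> A}"
  let ?B = "f -` A \<inter> space sphere_measure"
  have B: "?B \<in> sets sphere_measure" by measurable
  have cone: "?cone ?B = f -` ?cone A"
  proof (intro equalityI subsetI)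
    fix x assume "x \<in> f -` ?cone A"
    then obtain t z where tz: "f x = t *\<^sub>R z" "0 < t" "t < 1" "z \<in> A" by auto
    then have "f (x /\<^sub>R t) = z" using lin by (simp add: linear_scale)
    moreover have "norm (x /\<^sub>R t) = 1"
      using calculation A' tz(4) nrm[of "x /\<^sub>R t"] by auto
    ultimately show "x \<in> ?cone ?B"
      using tz by (intro CollectI exI[of _ t] exI[of _ "x /\<^sub>R t"]) (auto simp: space_sphere_measure)
  next
    fix x assume "x \<in> ?cone ?B"
    then obtain t z where "x = t *\<^sub>R z" "0 < t" "t < 1" "f z \<in> A" by auto
    then show "x \<in> f -` ?cone A"
      using lin by (auto simp: linear_scale)
  qed
  have Ab: "A \<in> sets borel"
    using A by (auto simp: sets_sphere_measure sets_restrict_space)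
  have [measurable]: "(sgn :: 'a \<Rightarrow> 'a) \<in> borel_measurable borel"
    unfolding sgn_div_norm by measurable
  \<comment> \<open>As a Borel preimage under \<open>sgn\<close>, the cone is measurable, so the
    invariance of \<open>lborel\<close> applies to it.\<close>
  have "?cone A = ball 0 1 \<inter> sgn -` A"
  proof (intro equalityI subsetI)
    fix x assume x: "x \<in> ball 0 1 \<inter> sgn -` A"
    with A' have "norm (sgn x) = 1" by auto
    then have "x \<noteq> 0" by auto
    then have "x = norm x *\<^sub>R sgn x" "0 < norm x" by (auto simp: sgn_div_norm)
    then show "x \<in> ?cone A"
      using x by (intro CollectI exI[of _ "norm x"] exI[of _ "sgn x"]) auto
  next
    fix x assume "x \<in> ?cone A"
    then obtain t z where tz: "x = t *\<^sub>R z" "0 < t" "t < 1" "z \<in> A" by auto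
    with A' have "norm z = 1" by auto
    with tz show "x \<in> ball 0 1 \<inter> sgn -` A" by (simp add: sgn_div_norm)
  qed
  moreover have "ball 0 1 \<inter> sgn -` A \<in> sets borel"
    using measurable_sets[of "sgn :: 'a \<Rightarrow> 'a" borel borel A] Ab by auto
  ultimately have coneA: "?cone A \<in> sets borel" by simp
  have "emeasure lborel (f -` ?cone A) = emeasure (distr lborel borel f) (?cone A)"
    using coneA by (simp add: emeasure_distr)
  also have "\<dots> = emeasure lborel (?cone A)"
    by (simp add: distr_lborel_orthogonal_transformation[OF f])
  finally have "emeasure lborel (?cone ?B) = emeasure lborel (?cone A)"
    by (simp only: cone)
  then have "emeasure sphere_measure ?B = emeasure sphere_measure A"
    using A B by (simp only: emeasure_sphere_measure)
  then show "emeasure (distr sphere_measure sphere_measure f) A = emeasure sphere_measure A"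
    by (simp add: emeasure_distr)
qed simp

lemma integral_sphere_measure_orthogonal_transformation:
  fixes f :: "'a::euclidean_space \<Rightarrow> 'a::euclidean_space" and g :: "'a::euclidean_space \<Rightarrow> real"
  assumes f: "orthogonal_transformation f" and g: "g \<in> borel_measurable sphere_measure"
  shows "(\<integral>z. g (f z) \<partial>sphere_measure) = (\<integral>z. g z \<partial>sphere_measure)"
proof -
  have lin: "linear f" and nrm: "\<And>x. norm (f x) = norm x"
    using f by (simp_all add: orthogonal_transformation)
  have fb [measurable]: "f \<in> borel_measurable borel"
    using lin by (simp add: borel_measurable_continuous_onI linear_continuous_on linear_linear)
  have "f \<in> measurable sphere_measure sphere_measure"
    unfolding measurable_cong_sets[OF sets_sphere_measure sets_sphere_measure]
    by (rule measurable_restrict_space3) (auto simp: nrm)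
  then have "(\<integral>z. g (f z) \<partial>sphere_measure) = (\<integral>z. g z \<partial>distr sphere_measure sphere_measure f)"
    using g by (simp add: integral_distr)
  then show ?thesis
    by (simp add: distr_sphere_measure_orthogonal_transformation[OF f])
qed

section \<open>Differentiation under the integral sign\<close>

lemma has_real_derivative_integral:
  fixes f f' :: "real \<Rightarrow> 'a \<Rightarrow> real"
  assumes M: "finite_measure M" and S: "open S" "convex S" "t0 \<in> S"
    and int: "\<And>t. t \<in> S \<Longrightarrow> integrable M (f t)"
    and der: "\<And>t x. t \<in> S \<Longrightarrow> x \<in> space M \<Longrightarrow> ((\<lambda>t. f t x) has_real_derivative f' t x) (at t)"
    and bound: "\<And>t x. t \<in> S \<Longrightarrow> x \<in> space M \<Longrightarrow> \<bar>f' t x\<bar> \<le> B"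
    and meas: "f' t0 \<in> borel_measurable M"
  shows "((\<lambda>t. \<integral>x. f t x \<partial>M) has_real_derivative (\<integral>x. f' t0 x \<partial>M)) (at t0)"
proof -
  interpret finite_measure M by fact
  \<comment> \<open>The mean value theorem on the convex set \<open>S\<close> turns the bound on the
    derivative into one on the difference quotients. On a finite measure the constant
    \<open>B\<close> is an integrable dominating function.\<close>
  have lip: "\<bar>(f t x - f t0 x) / (t - t0)\<bar> \<le> B" if "t \<in> S" "x \<in> space M" "t \<noteq> t0" for t x
  proof -
    have "norm (f t x - f t0 x) \<le> B * norm (t - t0)"
      using that S by (intro field_differentiable_bound[of S "\<lambda>t. f t x" "\<lambda>t. f' t x"])
         (auto intro: has_field_derivative_at_within[OF der] bound)
    with that show ?thesis by (simp add: field_simps)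
  qed
  have "((\<lambda>t. \<integral>x. (f t x - f t0 x) / (t - t0) \<partial>M) \<longlongrightarrow> (\<integral>x. f' t0 x \<partial>M)) (at t0)"
    unfolding tendsto_at_iff_sequentially
  proof safe
    fix X :: "nat \<Rightarrow> real"
    assume X: "\<forall>i. X i \<in> UNIV - {t0}" "X \<longlonglongrightarrow> t0"
    then have "eventually (\<lambda>i. X i \<in> S) sequentially"
      using S by (auto dest: topological_tendstoD)
    \<comment> \<open>The first \<open>N\<close> terms are dropped because dominated convergence
      asks for the bound at every index.\<close>
    then obtain N where "\<And>i. N \<le> i \<Longrightarrow> X i \<in> S"
      unfolding eventually_sequentially by blast
    then have N: "\<And>i. X (i + N) \<in> S" by simp
    have XN: "(\<lambda>i. X (i + N)) \<longlonglongrightarrow> t0"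
      using X(2) by (rule LIMSEQ_ignore_initial_segment)
    have "(\<lambda>i. \<integral>x. (f (X (i + N)) x - f t0 x) / (X (i + N) - t0) \<partial>M) \<longlonglongrightarrow> (\<integral>x. f' t0 x \<partial>M)"
    proof (rule integral_dominated_convergence[where w = "\<lambda>_. B"])
      show "f' t0 \<in> borel_measurable M" by fact
      show "(\<lambda>x. (f (X (i + N)) x - f t0 x) / (X (i + N) - t0)) \<in> borel_measurable M" for i
        using int[OF N[of i]] int[OF S(3)] by auto
      show "AE x in M. (\<lambda>i. (f (X (i + N)) x - f t0 x) / (X (i + N) - t0)) \<longlonglongrightarrow> f' t0 x"
      proof (rule AE_I2)
        fix x assume x: "x \<in> space M"
        have "((\<lambda>t. (f t x - f t0 x) / (t - t0)) \<longlongrightarrow> f' t0 x) (at t0)"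
          using der[OF S(3) x] by (simp add: has_field_derivative_iff)
        then show "(\<lambda>i. (f (X (i + N)) x - f t0 x) / (X (i + N) - t0)) \<longlonglongrightarrow> f' t0 x"
          using X(1) XN by (force simp: tendsto_at_iff_sequentially o_def)
      qed
      show "AE x in M. norm ((f (X (i + N)) x - f t0 x) / (X (i + N) - t0)) \<le> B" for i
        using lip[OF N[of i]] X(1) by (intro AE_I2) auto
    qed simp
    then show "((\<lambda>t. \<integral>x. (f t x - f t0 x) / (t - t0) \<partial>M) \<circ> X) \<longlonglongrightarrow> (\<integral>x. f' t0 x \<partial>M)"
      by (simp add: o_def LIMSEQ_offset[where k = N])
  qed
  moreover have "\<forall>\<^sub>F t in at t0. (\<integral>x. (f t x - f t0 x) / (t - t0) \<partial>M)
      = ((\<integral>x. f t x \<partial>M) - (\<integral>x. f t0 x \<partial>M)) / (t - t0)"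
    using eventually_at_in_open'[OF S(1) S(3)]
    by eventually_elim (simp add: int S(3))
  ultimately show ?thesis
    unfolding has_field_derivative_iff by (rule Lim_transform_eventually)
qed

subsection \<open>Integrals of zonal functions\<close>

lemma integrable_sphere_measure_continuous:
  fixes g :: "'a::euclidean_space \<Rightarrow> real"
  assumes "continuous_on (sphere 0 1) g"
  shows "integrable sphere_measure g"
proof -
  interpret finite_measure "sphere_measure :: 'a measure" by (rule finite_measure_sphere_measure)
  have "compact (g ` sphere 0 1)"
    using assms by (intro compact_continuous_image) auto
  then obtain B where "\<And>x. x \<in> sphere 0 1 \<Longrightarrow> norm (g x) \<le> B"
    by (meson bounded_iff compact_imp_bounded imageI)
  moreover have "g \<in> borel_measurable sphere_measure"
    unfolding measurable_cong_sets[OF sets_sphere_measure refl]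
    using assms by (rule borel_measurable_continuous_on_restrict)
  ultimately show ?thesis
    by (intro integrable_const_bound[where B = B]) (auto simp: space_sphere_measure intro!: AE_I2)
qed

lemma inner_sphere_bounds:
  fixes z v :: "'a::euclidean_space"
  assumes "norm z = 1" "norm v = 1"
  shows "z \<bullet> v \<in> {-1..1}"
  using Cauchy_Schwarz_ineq2[of z v] assms by (simp add: abs_le_iff)

lemma orthogonal_transformation_planar_rotation:
  fixes e f :: "'a::euclidean_space"
  assumes e: "norm e = 1" and f: "norm f = 1" and ef: "e \<bullet> f = 0" and cs: "c\<^sup>2 + s\<^sup>2 = (1::real)"
  obtains U where "orthogonal_transformation U" "U e = c *\<^sub>R e + s *\<^sub>R f" "U f = c *\<^sub>R f - s *\<^sub>R e"
proof -
  \<comment> \<open>Rotation in the plane of \<open>e\<close> and \<open>f\<close> and the identity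
    on its orthogonal complement, written as \<open>x\<close> plus a correction in the
    plane.\<close>
  define U where "U x = x + ((c - 1) * (x \<bullet> e) - s * (x \<bullet> f)) *\<^sub>R e
    + ((c - 1) * (x \<bullet> f) + s * (x \<bullet> e)) *\<^sub>R f" for x
  have ee: "e \<bullet> e = 1" "f \<bullet> f = 1" "f \<bullet> e = 0"
    using e f ef by (simp_all add: norm_eq_1 inner_commute)
  have "linear U"
    by (rule linearI) (simp_all add: U_def inner_add_left algebra_simps)
  moreover have "U x \<bullet> U x = x \<bullet> x" for x
  proof -
    define p q where "p = x \<bullet> e" and "q = x \<bullet> f"
    define a b where "a = (c - 1) * p - s * q" and "b = (c - 1) * q + s * p"
    have "U x \<bullet> U x = x \<bullet> x + 2 * (a * p + b * q) + (a\<^sup>2 + b\<^sup>2)"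
      by (simp add: U_def inner_add_left inner_add_right ee ef p_def[symmetric] q_def[symmetric]
          a_def[symmetric] b_def[symmetric] inner_commute[of e x] inner_commute[of f x])
        (simp add: power2_eq_square algebra_simps)
    moreover have "2 * (a * p + b * q) + (a\<^sup>2 + b\<^sup>2) = 0"
      using cs unfolding a_def b_def by algebra
    ultimately show ?thesis by simp
  qed
  ultimately have "orthogonal_transformation U"
    unfolding orthogonal_transformation by (simp add: norm_eq_sqrt_inner)
  moreover have "U e = c *\<^sub>R e + s *\<^sub>R f" "U f = c *\<^sub>R f - s *\<^sub>R e"
    by (simp_all add: U_def ee ef algebra_simps)
  ultimately show ?thesis using that by blast
qed

text \<open>The integral of \<open>k (z \<bullet> v) * (z \<bullet> w)\<close> does not change when the orthonormal pair \<open>(v, w)\<close> is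
  rotated in its plane; the claim is its derivative with respect to the angle.\<close>

lemma integral_sphere_zonal_orthonormal:
  fixes e f :: "'a::euclidean_space"
  assumes e: "norm e = 1" and f: "norm f = 1" and ef: "e \<bullet> f = 0"
    and der: "\<And>t. t \<in> {-1..1} \<Longrightarrow> (k has_real_derivative k' t) (at t)"
    and cont: "continuous_on {-1..1} k'"
  shows "(\<integral>z. k' (z \<bullet> e) * (z \<bullet> f)\<^sup>2 - k (z \<bullet> e) * (z \<bullet> e) \<partial>sphere_measure) = 0"
proof -
  \<comment> \<open>The rotated pair satisfies \<open>v' = w\<close> and \<open>w' = - v\<close>, so
    \<open>F'\<close> below is the derivative of \<open>F\<close> with respect to the angle.\<close>
  define v w where "v t = cos t *\<^sub>R e + sin t *\<^sub>R f" and "w t = cos t *\<^sub>R f - sin t *\<^sub>R e" for t :: real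
  have ee: "e \<bullet> e = 1" "f \<bullet> f = 1" "f \<bullet> e = 0"
    using e f ef by (simp_all add: norm_eq_1 inner_commute)
  have v1: "norm (v t) = 1" and w1: "norm (w t) = 1" for t
    by (simp_all add: v_def w_def norm_eq_1 inner_simps ee ef flip: power2_eq_square)
  have kc: "continuous_on {-1..1} k"
    using der by (intro DERIV_atLeastAtMost_imp_continuous_on) (meson atLeastAtMost_iff)
  have comp: "continuous_on (sphere 0 1) (\<lambda>z. h (z \<bullet> u))"
    if "continuous_on {-1..1} h" "norm u = 1" for h :: "real \<Rightarrow> real" and u :: 'a
    using that(1) by (rule continuous_on_compose2) (auto intro!: continuous_intros inner_sphere_bounds that simp del: atLeastAtMost_iff)
  have bdd: "\<exists>B. \<forall>t\<in>{-1..1}. \<bar>h t\<bar> \<le> B" if "continuous_on {-1..1} h" for h :: "real \<Rightarrow> real"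
    using compact_imp_bounded[OF compact_continuous_image[OF that]] by (auto simp: bounded_iff)
  obtain B1 B2 where B: "\<And>t. t \<in> {-1..1} \<Longrightarrow> \<bar>k t\<bar> \<le> B1" "\<And>t. t \<in> {-1..1} \<Longrightarrow> \<bar>k' t\<bar> \<le> B2"
    using bdd[OF kc] bdd[OF cont] by blast
  define F where "F t z = k (z \<bullet> v t) * (z \<bullet> w t)" for t z
  define F' where "F' t z = k' (z \<bullet> v t) * (z \<bullet> w t)\<^sup>2 - k (z \<bullet> v t) * (z \<bullet> v t)" for t z
  have Fint: "integrable sphere_measure (F t)" for t
    unfolding F_def using v1 kc by (intro integrable_sphere_measure_continuous continuous_intros comp)
  have "((\<lambda>t. \<integral>z. F t z \<partial>sphere_measure) has_real_derivative (\<integral>z. F' 0 z \<partial>sphere_measure)) (at 0)"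
  proof (rule has_real_derivative_integral[where S = UNIV and B = "B2 + B1"])
    fix t and z :: 'a assume "z \<in> space sphere_measure"
    then have z: "norm z = 1" by (simp add: space_sphere_measure)
    note zv = inner_sphere_bounds[OF z v1[of t]] and zw = inner_sphere_bounds[OF z w1[of t]]
    have dv: "((\<lambda>t. z \<bullet> v t) has_real_derivative z \<bullet> w t) (at t)"
      unfolding v_def w_def inner_simps by (auto intro!: derivative_eq_intros)
    have dw: "((\<lambda>t. z \<bullet> w t) has_real_derivative - (z \<bullet> v t)) (at t)"
      unfolding v_def w_def inner_simps by (auto intro!: derivative_eq_intros)
    have "((\<lambda>t. k (z \<bullet> v t)) has_real_derivative k' (z \<bullet> v t) * (z \<bullet> w t)) (at t)"
      using DERIV_chain2[OF der[OF zv] dv] .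
    from DERIV_mult[OF this dw]
    show "((\<lambda>t. F t z) has_real_derivative F' t z) (at t)"
      unfolding F_def F'_def by (simp add: power2_eq_square algebra_simps)
    have "\<bar>F' t z\<bar> \<le> \<bar>k' (z \<bullet> v t)\<bar> * \<bar>z \<bullet> w t\<bar>\<^sup>2 + \<bar>k (z \<bullet> v t)\<bar> * \<bar>z \<bullet> v t\<bar>"
      unfolding F'_def abs_mult[symmetric] power_abs[symmetric] by linarith
    also have "\<dots> \<le> B2 * 1 + B1 * 1"
      using B[OF zv] zv zw by (intro add_mono mult_mono power_le_one) (auto simp: abs_le_iff)
    finally show "\<bar>F' t z\<bar> \<le> B2 + B1" by simp
  next
    show "F' 0 \<in> borel_measurable sphere_measure"
      unfolding F'_def using v1 kc cont
      by (intro borel_measurable_integrable integrable_sphere_measure_continuous continuous_intros comp)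
  qed (simp_all add: finite_measure_sphere_measure Fint)
  \<comment> \<open>The rotation \<open>U\<close> with \<open>U e = v t\<close> and
    \<open>U f = w t\<close> preserves inner products, so \<open>F t (U z) = F 0 z\<close>;
    invariance of the measure makes the integral constant in \<open>t\<close>.\<close>
  moreover have "(\<lambda>t. \<integral>z. F t z \<partial>sphere_measure) = (\<lambda>t. \<integral>z. F 0 z \<partial>sphere_measure)"
  proof
    fix t
    obtain U where U: "orthogonal_transformation U" "U e = v t" "U f = w t"
      unfolding v_def w_def
      using orthogonal_transformation_planar_rotation[OF e f ef, of "cos t" "sin t"] by auto
    have "(\<integral>z. F t z \<partial>sphere_measure) = (\<integral>z. F t (U z) \<partial>sphere_measure)"
      using Fint by (intro integral_sphere_measure_orthogonal_transformation[symmetric] U) auto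
    moreover have "F t (U z) = F 0 z" for z
      using U by (simp add: F_def orthogonal_transformation_def v_def[of 0] w_def[of 0] flip: U(2,3))
    ultimately show "(\<integral>z. F t z \<partial>sphere_measure) = (\<integral>z. F 0 z \<partial>sphere_measure)" by simp
  qed
  ultimately have "((\<lambda>t. \<integral>z. F 0 z \<partial>sphere_measure) has_real_derivative (\<integral>z. F' 0 z \<partial>sphere_measure)) (at 0)"
    by simp
  then have "(\<integral>z. F' 0 z \<partial>sphere_measure) = 0"
    using DERIV_unique DERIV_const by blast
  then show ?thesis
    by (simp add: F'_def v_def w_def)
qed

text \<open>The orthonormal case is summed over the n - 1 basis vectors other than \<open>e\<close>:
  on the sphere the squares (z \<bullet> f)^2 add up to 1 - (z \<bullet> e)^2. This replaces an
  integration by parts against the density of z \<bullet> e, which never has to be computed.\<close>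

lemma integral_sphere_zonal_by_parts:
  fixes e :: "'a::euclidean_space"
  assumes e: "e \<in> Basis"
    and der: "\<And>t. t \<in> {-1..1} \<Longrightarrow> (k has_real_derivative k' t) (at t)"
    and cont: "continuous_on {-1..1} k'"
  shows "(\<integral>z. k' (z \<bullet> e) * (1 - (z \<bullet> e)\<^sup>2) \<partial>sphere_measure)
    = (real DIM('a) - 1) * (\<integral>z. k (z \<bullet> e) * (z \<bullet> e) \<partial>sphere_measure)"
proof -
  have kc: "continuous_on {-1..1} k"
    using der by (intro DERIV_atLeastAtMost_imp_continuous_on) (meson atLeastAtMost_iff)
  have comp: "continuous_on (sphere 0 1) (\<lambda>z. h (z \<bullet> e))"
    if "continuous_on {-1..1} h" for h :: "real \<Rightarrow> real"
    using that by (rule continuous_on_compose2)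
      (use e in \<open>auto intro!: continuous_intros inner_sphere_bounds simp del: atLeastAtMost_iff\<close>)
  have int1: "integrable sphere_measure (\<lambda>z. k' (z \<bullet> e) * (z \<bullet> f)\<^sup>2)" for f
    using cont by (intro integrable_sphere_measure_continuous continuous_intros comp)
  have int2: "integrable sphere_measure (\<lambda>z. k (z \<bullet> e) * (z \<bullet> e))"
    using kc by (intro integrable_sphere_measure_continuous continuous_intros comp)
  have "(\<integral>z. k' (z \<bullet> e) * (1 - (z \<bullet> e)\<^sup>2) \<partial>sphere_measure)
      = (\<integral>z. (\<Sum>f\<in>Basis - {e}. k' (z \<bullet> e) * (z \<bullet> f)\<^sup>2) \<partial>sphere_measure)"
  proof (rule Bochner_Integration.integral_cong[OF refl])
    fix z :: 'a assume "z \<in> space sphere_measure"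
    then have "1 = z \<bullet> z" by (simp add: space_sphere_measure norm_eq_1)
    also have "\<dots> = (\<Sum>f\<in>Basis. (z \<bullet> f)\<^sup>2)"
      by (subst euclidean_inner) (simp add: power2_eq_square)
    also have "\<dots> = (z \<bullet> e)\<^sup>2 + (\<Sum>f\<in>Basis - {e}. (z \<bullet> f)\<^sup>2)"
      using e by (simp add: sum.remove)
    finally show "k' (z \<bullet> e) * (1 - (z \<bullet> e)\<^sup>2) = (\<Sum>f\<in>Basis - {e}. k' (z \<bullet> e) * (z \<bullet> f)\<^sup>2)"
      by (simp add: sum_distrib_left[symmetric])
  qed
  also have "\<dots> = (\<Sum>f\<in>Basis - {e}. \<integral>z. k' (z \<bullet> e) * (z \<bullet> f)\<^sup>2 \<partial>sphere_measure)"
    by (rule Bochner_Integration.integral_sum) (rule int1)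
  also have "\<dots> = (\<Sum>f\<in>Basis - {e}. \<integral>z. k (z \<bullet> e) * (z \<bullet> e) \<partial>sphere_measure)"
  proof (rule sum.cong[OF refl])
    fix f assume "f \<in> Basis - {e}"
    then have "norm f = 1" "e \<bullet> f = 0" using e by (auto simp: inner_Basis)
    with integral_sphere_zonal_orthonormal[of e f k k'] e der cont int1 int2
    show "(\<integral>z. k' (z \<bullet> e) * (z \<bullet> f)\<^sup>2 \<partial>sphere_measure) = (\<integral>z. k (z \<bullet> e) * (z \<bullet> e) \<partial>sphere_measure)"
      by simp
  qed
  also have "\<dots> = (real DIM('a) - 1) * (\<integral>z. k (z \<bullet> e) * (z \<bullet> e) \<partial>sphere_measure)"
    using e DIM_positive[where 'a='a] by (simp add: card_Diff_singleton of_nat_diff Suc_leI)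
  finally show ?thesis .
qed

definition zonal_integral :: "'a::euclidean_space \<Rightarrow> real \<Rightarrow> real \<Rightarrow> real"
  where "zonal_integral e g r = (\<integral>z. (1 + r\<^sup>2 - 2 * r * (z \<bullet> e)) powr g \<partial>sphere_measure)"

text \<open>Bounds uniform in \<open>r\<close> and from both sides, since powers of the base with
  exponents of either sign have to be dominated.\<close>

lemma zonal_base_bounds:
  fixes r t :: real
  assumes "\<bar>r\<bar> \<le> \<rho>" "\<rho> \<le> 1" "t \<in> {-1..1}"
  shows "(1 - \<rho>)\<^sup>2 \<le> 1 + r\<^sup>2 - 2 * r * t" "1 + r\<^sup>2 - 2 * r * t \<le> 4"
proof -
  have "\<bar>r * t\<bar> \<le> \<bar>r\<bar>"
    using assms by (simp add: abs_mult mult_left_le abs_le_iff)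
  then have *: "r * t \<le> \<bar>r\<bar>" "- (r * t) \<le> \<bar>r\<bar>" by linarith+
  have "(1 - \<rho>)\<^sup>2 \<le> (1 - \<bar>r\<bar>)\<^sup>2"
    using assms by (intro power_mono) auto
  also have "\<dots> = 1 + r\<^sup>2 - 2 * \<bar>r\<bar>"
    by (simp add: power2_eq_square algebra_simps)
  also have "\<dots> \<le> 1 + r\<^sup>2 - 2 * r * t"
    using * by simp
  finally show "(1 - \<rho>)\<^sup>2 \<le> 1 + r\<^sup>2 - 2 * r * t" .
  have "r\<^sup>2 \<le> 1" "\<bar>r\<bar> \<le> 1"
    using assms by (auto simp: abs_square_le_1)
  then show "1 + r\<^sup>2 - 2 * r * t \<le> 4"
    using * by linarith
qed

lemma zonal_base_pos:
  fixes r t :: real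
  assumes "\<bar>r\<bar> < 1" "t \<in> {-1..1}"
  shows "0 < 1 + r\<^sup>2 - 2 * r * t"
proof -
  have "0 < (1 - \<bar>r\<bar>)\<^sup>2" using assms by simp
  with zonal_base_bounds(1)[of r "\<bar>r\<bar>" t] assms show ?thesis by linarith
qed

lemma inner_sphere_Basis_bounds:
  fixes z e :: "'a::euclidean_space"
  assumes "e \<in> Basis" "z \<in> space sphere_measure"
  shows "z \<bullet> e \<in> {-1..1}"
  using assms by (intro inner_sphere_bounds) (simp_all add: space_sphere_measure)

lemma integrable_zonal:
  fixes e :: "'a::euclidean_space"
  assumes e: "e \<in> Basis" and r: "\<bar>r\<bar> < 1" and h: "continuous_on UNIV h"
  shows "integrable sphere_measure (\<lambda>z. (1 + r\<^sup>2 - 2 * r * (z \<bullet> e)) powr g * h (z \<bullet> e))"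
proof (intro integrable_sphere_measure_continuous continuous_intros ballI)
  fix z :: 'a assume "z \<in> sphere 0 1"
  with zonal_base_pos[OF r inner_sphere_Basis_bounds[OF e, of z]]
  show "1 + r\<^sup>2 - 2 * r * (z \<bullet> e) \<noteq> 0"
    by (simp add: space_sphere_measure)
qed (rule continuous_on_compose2[OF h], auto intro!: continuous_intros)

lemma integrable_zonal_powr:
  fixes e :: "'a::euclidean_space"
  assumes "e \<in> Basis" "\<bar>r\<bar> < 1"
  shows "integrable sphere_measure (\<lambda>z. (1 + r\<^sup>2 - 2 * r * (z \<bullet> e)) powr g)"
  using integrable_zonal[OF assms, of "\<lambda>_. 1" g] by simp

lemma zonal_integral_0: "zonal_integral (e :: 'a::euclidean_space) g 0 = 1"
  by (simp add: zonal_integral_def measure_def space_sphere_measure prob_sphere_measure)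

lemma zonal_integral_pos:
  fixes e :: "'a::euclidean_space"
  assumes e: "e \<in> Basis" and r: "\<bar>r\<bar> < 1"
  shows "0 < zonal_integral e g r"
proof -
  have "0 \<le> zonal_integral e g r"
    by (simp add: zonal_integral_def)
  moreover have "zonal_integral e g r \<noteq> 0"
  proof
    assume "zonal_integral e g r = 0"
    then have "AE z in (sphere_measure :: 'a measure). (1 + r\<^sup>2 - 2 * r * (z \<bullet> e)) powr g = 0"
      unfolding zonal_integral_def
      by (subst (asm) integral_nonneg_eq_0_iff_AE[OF integrable_zonal_powr[OF e r]]) auto
    moreover have "AE z in (sphere_measure :: 'a measure). (1 + r\<^sup>2 - 2 * r * (z \<bullet> e)) powr g \<noteq> 0"
    proof (rule AE_I2)
      fix z :: 'a assume "z \<in> space sphere_measure"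
      from zonal_base_pos[OF r inner_sphere_Basis_bounds[OF e this]]
      show "(1 + r\<^sup>2 - 2 * r * (z \<bullet> e)) powr g \<noteq> 0"
        by simp
    qed
    ultimately have "AE z in (sphere_measure :: 'a measure). False"
      by eventually_elim simp
    then show False
      by (simp add: eventually_False ae_filter_eq_bot_iff space_sphere_measure prob_sphere_measure)
  qed
  ultimately show ?thesis by simp
qed

text \<open>A real power is monotone in a direction that depends on the sign of \<open>d\<close>;
  the sum of the two endpoint values covers both directions.\<close>

lemma powr_le_endpoints:
  fixes x a b d :: real
  assumes "0 < a" "a \<le> x" "x \<le> b"
  shows "x powr d \<le> a powr d + b powr d"
proof (cases "0 \<le> d")
  case True
  then have "x powr d \<le> b powr d" using assms by (intro powr_mono2) auto
  then show ?thesis by (simp add: add_increasing)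
next
  case False
  then have "x powr d \<le> a powr d" using assms by (intro powr_mono2') auto
  then show ?thesis by (simp add: add_increasing2)
qed

lemma DERIV_zonal_integral_raw:
  fixes e :: "'a::euclidean_space"
  assumes e: "e \<in> Basis" and r: "\<bar>r\<bar> < 1"
  shows "(zonal_integral e g has_real_derivative
    (\<integral>z. g * (1 + r\<^sup>2 - 2 * r * (z \<bullet> e)) powr (g - 1) * (2 * r - 2 * (z \<bullet> e)) \<partial>sphere_measure)) (at r)"
proof -
  \<comment> \<open>Such a \<open>\<rho>\<close> gives a neighbourhood of \<open>r\<close> on which
    the base stays between (1 - \<rho>)^2 and 4. The last factor 4 in \<open>B\<close> bounds |2 t -
    2 (z \<bullet> e)|.\<close>
  obtain \<rho> where \<rho>: "\<bar>r\<bar> < \<rho>" "\<rho> < 1" using r dense by blast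
  define B where "B = \<bar>g\<bar> * (((1 - \<rho>)\<^sup>2) powr (g - 1) + 4 powr (g - 1)) * 4"
  have "((\<lambda>r. \<integral>z. (1 + r\<^sup>2 - 2 * r * (z \<bullet> e)) powr g \<partial>sphere_measure) has_real_derivative
    (\<integral>z. g * (1 + r\<^sup>2 - 2 * r * (z \<bullet> e)) powr (g - 1) * (2 * r - 2 * (z \<bullet> e)) \<partial>sphere_measure)) (at r)"
  proof (rule has_real_derivative_integral[where S = "{-\<rho><..<\<rho>}" and B = B])
    fix t assume t: "t \<in> {-\<rho><..<\<rho>}"
    then have t1: "\<bar>t\<bar> < 1" "\<bar>t\<bar> \<le> \<rho>" "\<rho> \<le> 1" using \<rho> by auto
    show "integrable sphere_measure (\<lambda>z. (1 + t\<^sup>2 - 2 * t * (z \<bullet> e)) powr g)"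
      using integrable_zonal_powr[OF e] t1 by blast
    fix z :: 'a assume z: "z \<in> space sphere_measure"
    note s = inner_sphere_Basis_bounds[OF e z]
    note Q = zonal_base_pos[OF t1(1) s]
    show "((\<lambda>t. (1 + t\<^sup>2 - 2 * t * (z \<bullet> e)) powr g) has_real_derivative
        g * (1 + t\<^sup>2 - 2 * t * (z \<bullet> e)) powr (g - 1) * (2 * t - 2 * (z \<bullet> e))) (at t)"
      using Q by (auto intro!: derivative_eq_intros simp: algebra_simps)
    have "0 < (1 - \<rho>)\<^sup>2" using \<rho> by simp
    then have "(1 + t\<^sup>2 - 2 * t * (z \<bullet> e)) powr (g - 1) \<le> ((1 - \<rho>)\<^sup>2) powr (g - 1) + 4 powr (g - 1)"
      using zonal_base_bounds[OF t1(2,3) s] by (intro powr_le_endpoints) auto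
    moreover have "\<bar>2 * t - 2 * (z \<bullet> e)\<bar> \<le> 4"
      using s t1(1) by auto
    ultimately show "\<bar>g * (1 + t\<^sup>2 - 2 * t * (z \<bullet> e)) powr (g - 1) * (2 * t - 2 * (z \<bullet> e))\<bar> \<le> B"
      unfolding abs_mult B_def by (intro mult_mono) auto
  next
    show "(\<lambda>z. g * (1 + r\<^sup>2 - 2 * r * (z \<bullet> e)) powr (g - 1) * (2 * r - 2 * (z \<bullet> e))) \<in> borel_measurable sphere_measure"
      by measurable
  qed (use \<rho> in \<open>auto simp: finite_measure_sphere_measure\<close>)
  then show ?thesis
    by (simp add: zonal_integral_def[abs_def])
qed

lemma isCont_zonal_integral:
  "e \<in> Basis \<Longrightarrow> \<bar>r\<bar> < 1 \<Longrightarrow> isCont (zonal_integral (e :: 'a::euclidean_space) g) r"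
  using DERIV_zonal_integral_raw by (rule DERIV_isCont)

text \<open>For Q = 1 + r^2 - 2 r s, r times the derivative of Q in r is Q - (1 - r^2).
  Differentiation therefore leads back to zonal integrals, with exponents g and g - 1.\<close>

lemma DERIV_zonal_integral:
  fixes e :: "'a::euclidean_space"
  assumes e: "e \<in> Basis" and r: "\<bar>r\<bar> < 1" "r \<noteq> 0"
  shows "(zonal_integral e g has_real_derivative
    g * (zonal_integral e g r - (1 - r\<^sup>2) * zonal_integral e (g - 1) r) / r) (at r)"
proof -
  let ?Q = "\<lambda>z. 1 + r\<^sup>2 - 2 * r * (z \<bullet> e)"
  have ring: "r * (g * P * (2 * r - 2 * s)) = g * ((1 + r\<^sup>2 - 2 * r * s) * P - (1 - r\<^sup>2) * P)" for P s
    by (simp add: power2_eq_square algebra_simps)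
  have div: "I = E / r" if "r * I = E" for I E
    using that r(2) by (simp add: field_simps)
  have "r * (\<integral>z. g * ?Q z powr (g - 1) * (2 * r - 2 * (z \<bullet> e)) \<partial>sphere_measure)
      = (\<integral>z. g * (?Q z powr g - (1 - r\<^sup>2) * ?Q z powr (g - 1)) \<partial>sphere_measure)"
    unfolding integral_mult_right_zero[symmetric]
  proof (rule Bochner_Integration.integral_cong[OF refl])
    fix z :: 'a assume z: "z \<in> space sphere_measure"
    have "?Q z powr g = ?Q z * ?Q z powr (g - 1)"
      using zonal_base_pos[OF r(1) inner_sphere_Basis_bounds[OF e z]]
      using powr_mult_base[of "?Q z" "g - 1"] by simp
    then show "r * (g * ?Q z powr (g - 1) * (2 * r - 2 * (z \<bullet> e)))
        = g * (?Q z powr g - (1 - r\<^sup>2) * ?Q z powr (g - 1))"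
      by (simp only: ring)
  qed
  also have "\<dots> = g * (zonal_integral e g r - (1 - r\<^sup>2) * zonal_integral e (g - 1) r)"
    by (simp add: zonal_integral_def integrable_zonal_powr[OF e r(1)])
  finally have "(\<integral>z. g * ?Q z powr (g - 1) * (2 * r - 2 * (z \<bullet> e)) \<partial>sphere_measure)
      = g * (zonal_integral e g r - (1 - r\<^sup>2) * zonal_integral e (g - 1) r) / r"
    by (rule div)
  then show ?thesis
    using DERIV_zonal_integral_raw[OF e r(1), of g] by (simp only:)
qed

text \<open>Integration by parts for Q^(g - 1), multiplied by 2 r. The substitutions 2 r t = 1 + r^2
  - Q and 4 r^2 (1 - t^2) = - (1 - r^2)^2 + 2 (1 + r^2) Q - Q^2 turn both sides into powers of Q.
  There is no division by \<open>r\<close>, so \<open>r = 0\<close> is included.\<close>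

lemma zonal_integral_contiguous:
  fixes e :: "'a::euclidean_space"
  assumes e: "e \<in> Basis" and r: "\<bar>r\<bar> < 1"
  shows "(g - 1) * ((1 - r\<^sup>2)\<^sup>2 * zonal_integral e (g - 2) r
      - 2 * (1 + r\<^sup>2) * zonal_integral e (g - 1) r + zonal_integral e g r)
    = (real DIM('a) - 1) * ((1 + r\<^sup>2) * zonal_integral e (g - 1) r - zonal_integral e g r)"
proof -
  let ?Q = "\<lambda>z. 1 + r\<^sup>2 - 2 * r * (z \<bullet> e)"
  let ?k' = "\<lambda>t. (g - 1) * (- 2 * r) * (1 + r\<^sup>2 - 2 * r * t) powr (g - 2)"
  note int = integrable_zonal_powr[OF e r]
  \<comment> \<open>With all powers expressed through \<open>?Q z powr (g - 2)\<close>, the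
    identities between integrands below become polynomial.\<close>
  have Q1: "?Q z powr (g - 1) = ?Q z * ?Q z powr (g - 2)" "?Q z powr g = ?Q z * (?Q z * ?Q z powr (g - 2))"
    if "z \<in> space sphere_measure" for z
    using zonal_base_pos[OF r inner_sphere_Basis_bounds[OF e that]]
      powr_mult_base[of "?Q z" "g - 2"] powr_mult_base[of "?Q z" "g - 1"] by simp_all
  have "(\<integral>z. ?k' (z \<bullet> e) * (1 - (z \<bullet> e)\<^sup>2) \<partial>sphere_measure)
    = (real DIM('a) - 1) * (\<integral>z. ?Q z powr (g - 1) * (z \<bullet> e) \<partial>sphere_measure)"
  proof (rule integral_sphere_zonal_by_parts[OF e])
    fix t :: real assume t: "t \<in> {-1..1}"
    show "((\<lambda>t. (1 + r\<^sup>2 - 2 * r * t) powr (g - 1)) has_real_derivative ?k' t) (at t)"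
      using zonal_base_pos[OF r t] by (auto intro!: derivative_eq_intros)
  next
    show "continuous_on {-1..1} ?k'"
      using zonal_base_pos[OF r] by (intro continuous_intros ballI) force
  qed
  then have "(\<integral>z. 2 * r * (?k' (z \<bullet> e) * (1 - (z \<bullet> e)\<^sup>2)) \<partial>sphere_measure)
    = (real DIM('a) - 1) * (\<integral>z. 2 * r * (?Q z powr (g - 1) * (z \<bullet> e)) \<partial>sphere_measure)"
    by (simp only: integral_mult_right_zero mult.left_commute[of "2 * r" "real DIM('a) - 1"])
  also have "(\<integral>z. 2 * r * (?k' (z \<bullet> e) * (1 - (z \<bullet> e)\<^sup>2)) \<partial>sphere_measure)
    = (\<integral>z. (g - 1) * ((1 - r\<^sup>2)\<^sup>2 * ?Q z powr (g - 2) - 2 * (1 + r\<^sup>2) * ?Q z powr (g - 1) + ?Q z powr g) \<partial>sphere_measure)"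
    by (rule Bochner_Integration.integral_cong[OF refl], simp only: Q1) (simp add: power2_eq_square algebra_simps)
  also have "\<dots> = (g - 1) * ((1 - r\<^sup>2)\<^sup>2 * zonal_integral e (g - 2) r
      - 2 * (1 + r\<^sup>2) * zonal_integral e (g - 1) r + zonal_integral e g r)"
    by (simp add: zonal_integral_def int)
  also have "(\<integral>z. 2 * r * (?Q z powr (g - 1) * (z \<bullet> e)) \<partial>sphere_measure)
    = (\<integral>z. (1 + r\<^sup>2) * ?Q z powr (g - 1) - ?Q z powr g \<partial>sphere_measure)"
    by (rule Bochner_Integration.integral_cong[OF refl], simp only: Q1) (simp add: power2_eq_square algebra_simps)
  also have "\<dots> = (1 + r\<^sup>2) * zonal_integral e (g - 1) r - zonal_integral e g r"
    by (simp add: zonal_integral_def int)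
  finally show ?thesis .
qed

subsection \<open>The hypergeometric series\<close>

text \<open>Formal version of the series: the differential equation is checked on coefficients and
  only then carried over to the sum.\<close>

definition fps_2F1 :: "real \<Rightarrow> real \<Rightarrow> real \<Rightarrow> real fps"
  where "fps_2F1 a b c = fps_hypergeo [a, b] [c] 1"

lemma fps_2F1_nth:
  "fps_nth (fps_2F1 a b c) k = pochhammer a k * pochhammer b k / (fact k * pochhammer c k)"
  by (simp add: fps_2F1_def mult_ac)

lemma eval_fps_2F1: "eval_fps (fps_2F1 a b c) t = hypergeo_2F1 a b c t"
  by (simp add: fps_2F1_def hypergeo_2F1_eq_eval_fps)

lemma fps_2F1_nth_Suc:
  assumes "c > 0"
  shows "(real k + 1) * (real k + c) * fps_nth (fps_2F1 a b c) (Suc k)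
    = (real k + a) * (real k + b) * fps_nth (fps_2F1 a b c) k"
proof -
  have "pochhammer c k \<noteq> 0" "c + real k \<noteq> 0"
    using assms pochhammer_pos[of c k] by auto
  then show ?thesis
    by (simp add: fps_2F1_nth pochhammer_Suc divide_simps) (simp add: algebra_simps)
qed

lemma fps_2F1_ode:
  assumes "c > 0"
  shows "fps_X * (1 - fps_X) * fps_deriv (fps_deriv (fps_2F1 a b c))
    + (fps_const c - fps_const (a + b + 1) * fps_X) * fps_deriv (fps_2F1 a b c)
    = fps_const (a * b) * fps_2F1 a b c" (is "?L = ?R")
proof (rule fps_ext)
  fix k
  let ?H = "fps_2F1 a b c"
  have "?L = fps_X * fps_deriv (fps_deriv ?H) - fps_X * (fps_X * fps_deriv (fps_deriv ?H))
      + fps_const c * fps_deriv ?H - fps_const (a + b + 1) * (fps_X * fps_deriv ?H)"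
    by (simp add: algebra_simps)
  \<comment> \<open>The cases k = 0 and k = 1 are split off because the factors \<open>fps_X\<close>
    shift the index.\<close>
  then have "fps_nth ?L k = (real k + 1) * (real k + c) * fps_nth ?H (Suc k)
      - (real k * (real k - 1) + (a + b + 1) * real k) * fps_nth ?H k"
    by (cases k; cases "k - 1") (simp_all add: algebra_simps)
  also have "\<dots> = fps_nth ?R k"
    unfolding fps_2F1_nth_Suc[OF assms] by (simp add: algebra_simps)
  finally show "fps_nth ?L k = fps_nth ?R k" .
qed

section \<open>Growth of the coefficients and convergence up to 1\<close>

lemma pochhammer_bigo: "(\<lambda>k. pochhammer a (k + 1)) \<in> O(\<lambda>k. fact k * real k powr a)"
proof (rule bigoI_tendsto)
  \<comment> \<open>Gauss's limit for 1/Gamma. It also covers nonpositive integers \<open>a\<close>,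
    where the limit is 0.\<close>
  show "(\<lambda>k. pochhammer a (k + 1) / (fact k * real k powr a)) \<longlonglongrightarrow> rGamma a"
  proof (rule Lim_transform_eventually[OF rGamma_series_LIMSEQ])
    show "\<forall>\<^sub>F k in sequentially. rGamma_series a k = pochhammer a (k + 1) / (fact k * real k powr a)"
      using eventually_gt_at_top[of 0] by eventually_elim (simp add: rGamma_series_def powr_def)
  qed
  show "\<forall>\<^sub>F k in sequentially. fact k * real k powr a \<noteq> 0"
    using eventually_gt_at_top[of 0] by eventually_elim simp
qed

lemma pochhammer_bigo':
  assumes "c > 0"
  shows "(\<lambda>k. fact k * real k powr c) \<in> O(\<lambda>k. pochhammer c (k + 1))"
proof (rule bigoI_tendsto)
  \<comment> \<open>Positivity of \<open>c\<close> avoids the poles of Gamma, so the limit can be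
    inverted.\<close>
  have "rGamma c \<noteq> 0"
    using assms by (auto simp: rGamma_eq_zero_iff elim!: nonpos_Ints_cases)
  moreover have "\<forall>\<^sub>F k in sequentially. inverse (rGamma_series c k) = fact k * real k powr c / pochhammer c (k + 1)"
    using eventually_gt_at_top[of 0] by eventually_elim (simp add: rGamma_series_def powr_def)
  ultimately show "(\<lambda>k. fact k * real k powr c / pochhammer c (k + 1)) \<longlonglongrightarrow> inverse (rGamma c)"
    by (intro Lim_transform_eventually[OF tendsto_inverse[OF rGamma_series_LIMSEQ]])
  show "\<forall>\<^sub>F k in sequentially. pochhammer c (k + 1) \<noteq> 0"
    using pochhammer_pos[OF assms] by (intro always_eventually) (metis less_irrefl)
qed

text \<open>The coefficients are O(k^(a + b - c - 1)), and c - a - b > 0 puts this exponent below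
  -1.\<close>

lemma summable_fps_2F1:
  assumes "c > 0" "c - a - b > 0"
  shows "summable (\<lambda>k. norm (fps_nth (fps_2F1 a b c) k))"
proof -
  have "(\<lambda>k. pochhammer a (k + 1) * pochhammer b (k + 1)) \<in> O(\<lambda>k. (fact k * real k powr a) * (fact k * real k powr b))"
    by (intro landau_o.big.mult pochhammer_bigo)
  \<comment> \<open>The factorial is treated as the Pochhammer symbol of 1, whence the exponent
    1.\<close>
  moreover have "(\<lambda>k. (fact k * real k powr 1) * (fact k * real k powr c)) \<in> O(\<lambda>k. fact (k + 1) * pochhammer c (k + 1))"
    using pochhammer_bigo'[of 1] pochhammer_bigo'[OF assms(1)]
    by (intro landau_o.big.mult) (simp_all add: pochhammer_fact)
  ultimately have "(\<lambda>k. pochhammer a (k + 1) * pochhammer b (k + 1) / (fact (k + 1) * pochhammer c (k + 1)))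
      \<in> O(\<lambda>k. (fact k * real k powr a) * (fact k * real k powr b) / ((fact k * real k powr 1) * (fact k * real k powr c)))"
    using pochhammer_pos[OF assms(1)]
    by (intro landau_o.big.divide) (auto intro!: eventually_mono[OF eventually_gt_at_top[of 0]] simp: less_imp_neq[symmetric] less_imp_neq)
  also have "(\<lambda>k. (fact k * real k powr a) * (fact k * real k powr b) / ((fact k * real k powr 1) * (fact k * real k powr c)))
      \<in> O(\<lambda>k. real k powr (a + b - 1 - c))"
    by (intro bigoI[where c = 1] eventually_mono[OF eventually_gt_at_top[of 0]])
       (simp add: powr_diff powr_add field_simps)
  finally have "(\<lambda>k. fps_nth (fps_2F1 a b c) (k + 1)) \<in> O(\<lambda>k. real k powr (a + b - 1 - c))"
    by (simp add: fps_2F1_nth)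
  then have "(\<lambda>k. norm (fps_nth (fps_2F1 a b c) (k + 1))) \<in> O(\<lambda>k. real k powr (a + b - 1 - c))"
    by (simp only: real_norm_def landau_o.big.abs_in_iff)
  moreover have "summable (\<lambda>k. norm (real k powr (a + b - 1 - c)))"
    using assms by (simp add: summable_real_powr_iff)
  ultimately have "summable (\<lambda>k. norm (fps_nth (fps_2F1 a b c) (k + 1)))"
    by (rule summable_comparison_test_bigo[rotated])
  then show ?thesis
    using summable_iff_shift[of "\<lambda>k. norm (fps_nth (fps_2F1 a b c) k)" 1] by simp
qed

lemma fps_conv_radius_2F1:
  assumes "c > 0" "c - a - b > 0"
  shows "1 \<le> fps_conv_radius (fps_2F1 a b c)"
proof -
  have "summable (\<lambda>k. fps_nth (fps_2F1 a b c) k * 1 ^ k)"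
    using summable_norm_cancel[OF summable_fps_2F1[OF assms]] by simp
  from conv_radius_geI[OF this] show ?thesis
    by (simp add: fps_conv_radius_def one_ereal_def)
qed

lemma eval_fps_2F1_ode:
  assumes c: "c > 0" "c - a - b > 0" and t: "\<bar>t\<bar> < (1::real)"
  shows "t * (1 - t) * eval_fps (fps_deriv (fps_deriv (fps_2F1 a b c))) t
    + (c - (a + b + 1) * t) * eval_fps (fps_deriv (fps_2F1 a b c)) t = a * b * eval_fps (fps_2F1 a b c) t"
proof -
  let ?H = "fps_2F1 a b c"
  have r0: "ereal (norm t) < fps_conv_radius ?H"
    by (rule less_le_trans[OF _ fps_conv_radius_2F1[OF c]]) (simp add: t)
  then have r1: "ereal (norm t) < fps_conv_radius (fps_deriv ?H)"
    using fps_conv_radius_deriv by (rule less_le_trans)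
  then have r2: "ereal (norm t) < fps_conv_radius (fps_deriv (fps_deriv ?H))"
    using fps_conv_radius_deriv by (rule less_le_trans)
  \<comment> \<open>Each of these rules carries the radius of convergence along with the evaluation,
    so that evaluation can be pushed through the whole equation.\<close>
  have X: "eval_fps (fps_X * f) t = t * eval_fps f t" "ereal (norm t) < fps_conv_radius (fps_X * f)"
    if "ereal (norm t) < fps_conv_radius f" for f
    using that fps_conv_radius_mult[of fps_X f] by (simp_all add: eval_fps_mult less_le_trans)
  have C: "eval_fps (fps_const k * f) t = k * eval_fps f t" "ereal (norm t) < fps_conv_radius (fps_const k * f)"
    if "ereal (norm t) < fps_conv_radius f" for k f
    using that fps_conv_radius_mult[of "fps_const k" f] by (simp_all add: eval_fps_mult less_le_trans)
  have S: "eval_fps (f + g) t = eval_fps f t + eval_fps g t" "ereal (norm t) < fps_conv_radius (f + g)"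
    if "ereal (norm t) < fps_conv_radius f" "ereal (norm t) < fps_conv_radius g" for f g
    using that by (auto simp: eval_fps_add intro!: less_le_trans[OF _ fps_conv_radius_add])
  have D: "eval_fps (f - g) t = eval_fps f t - eval_fps g t" "ereal (norm t) < fps_conv_radius (f - g)"
    if "ereal (norm t) < fps_conv_radius f" "ereal (norm t) < fps_conv_radius g" for f g
    using that by (auto simp: eval_fps_diff intro!: less_le_trans[OF _ fps_conv_radius_diff])
  have "fps_X * fps_deriv (fps_deriv ?H) - fps_X * (fps_X * fps_deriv (fps_deriv ?H))
      + (fps_const c * fps_deriv ?H - fps_const (a + b + 1) * (fps_X * fps_deriv ?H))
      = fps_const (a * b) * ?H"
    using fps_2F1_ode[OF c(1), of a b] by (simp add: algebra_simps)
  from arg_cong[OF this, of "\<lambda>f. eval_fps f t"]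
  have "t * eval_fps (fps_deriv (fps_deriv ?H)) t - (t * (t * eval_fps (fps_deriv (fps_deriv ?H)) t))
    + (c * eval_fps (fps_deriv ?H) t - (a + b + 1) * (t * eval_fps (fps_deriv ?H) t)) = a * b * eval_fps ?H t"
    by (simp only: S D X C r0 r1 r2)
  then show ?thesis by (simp add: algebra_simps)
qed

lemma DERIV_eval_fps_2F1:
  assumes c: "c > 0" "c - a - b > 0" and t: "\<bar>t\<bar> < (1::real)"
  shows "(eval_fps (fps_2F1 a b c) has_real_derivative eval_fps (fps_deriv (fps_2F1 a b c)) t) (at t)"
    and "(eval_fps (fps_deriv (fps_2F1 a b c)) has_real_derivative
      eval_fps (fps_deriv (fps_deriv (fps_2F1 a b c))) t) (at t)"
proof -
  have r0: "ereal (norm t) < fps_conv_radius (fps_2F1 a b c)"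
    by (rule less_le_trans[OF _ fps_conv_radius_2F1[OF c]]) (simp add: t)
  then have r1: "ereal (norm t) < fps_conv_radius (fps_deriv (fps_2F1 a b c))"
    using fps_conv_radius_deriv by (rule less_le_trans)
  show "(eval_fps (fps_2F1 a b c) has_real_derivative eval_fps (fps_deriv (fps_2F1 a b c)) t) (at t)"
    using r0 by (rule has_field_derivative_eval_fps)
  show "(eval_fps (fps_deriv (fps_2F1 a b c)) has_real_derivative
      eval_fps (fps_deriv (fps_deriv (fps_2F1 a b c))) t) (at t)"
    using r1 by (rule has_field_derivative_eval_fps)
qed

text \<open>Weierstrass test with the absolute values of the coefficients as majorants. Continuity
  up to the endpoint identifies the limit at r = 1 later on.\<close>

lemma continuous_on_hypergeo_2F1:
  assumes c: "c > 0" "c - a - b > 0"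
  shows "continuous_on {0..1} (hypergeo_2F1 a b c)"
proof -
  let ?H = "fps_2F1 a b c"
  have "uniform_limit {0..1} (\<lambda>n t. \<Sum>k<n. fps_nth ?H k * t ^ k) (\<lambda>t. \<Sum>k. fps_nth ?H k * t ^ k) sequentially"
  proof (rule Weierstrass_m_test)
    fix k and t :: real assume "t \<in> {0..1}"
    then show "norm (fps_nth ?H k * t ^ k) \<le> norm (fps_nth ?H k)"
      by (simp add: abs_mult power_abs power_le_one mult_left_le)
  qed (rule summable_fps_2F1[OF c])
  then have "continuous_on {0..1} (\<lambda>t. \<Sum>k. fps_nth ?H k * t ^ k)"
    by (rule uniform_limit_theorem[rotated]) (auto intro!: always_eventually continuous_intros)
  then show ?thesis
    by (simp add: fps_2F1_nth hypergeo_2F1_def[abs_def])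
qed

subsection \<open>The hypergeometric equation for zonal integrals\<close>

definition poisson_zonal :: "'a::euclidean_space \<Rightarrow> real \<Rightarrow> real \<Rightarrow> real"
  where "poisson_zonal e \<alpha> r = (1 - r\<^sup>2) powr (2 * \<alpha> - real DIM('a) + 1) * zonal_integral e (- \<alpha>) r"

text \<open>For \<open>m = 2\<alpha> - n + 1\<close> this is \<open>r (1 - r\<^sup>2) \<Psi>'(r) / (1 - r\<^sup>2) powr m\<close>, where \<open>\<Psi>\<close> is \<^const>\<open>poisson_zonal\<close>.\<close>

definition zonal_flux :: "'a::euclidean_space \<Rightarrow> real \<Rightarrow> real \<Rightarrow> real"
  where "zonal_flux e \<alpha> r =
    (- 2 * (2 * \<alpha> - real DIM('a) + 1) * r\<^sup>2 - \<alpha> * (1 - r\<^sup>2)) * zonal_integral e (- \<alpha>) r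
    + \<alpha> * (1 - r\<^sup>2)\<^sup>2 * zonal_integral e (- \<alpha> - 1) r"

lemma one_minus_square_pos: "0 < 1 - r\<^sup>2" if "\<bar>r\<bar> < 1" for r :: real
  using that by (simp add: abs_square_less_1)

lemma DERIV_one_minus_square_powr:
  fixes r p :: real
  assumes "\<bar>r\<bar> < 1"
  shows "((\<lambda>r. (1 - r\<^sup>2) powr p) has_real_derivative - 2 * r * p * (1 - r\<^sup>2) powr (p - 1)) (at r)"
  using one_minus_square_pos[OF assms] by (auto intro!: derivative_eq_intros)

text \<open>Pure algebra for the derivative of \<open>zonal_flux\<close>: \<open>G\<close>,
  \<open>G1\<close>, \<open>G2\<close> stand for the zonal integrals with exponents -\<alpha>,
  -\<alpha> - 1, -\<alpha> - 2, the left side is r times the derivative, and \<open>rec\<close> is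
  the contiguous relation, used to eliminate \<open>G2\<close>.\<close>

lemma zonal_flux_derivative_identity:
  fixes n \<alpha> r G G1 G2 :: real
  defines "D \<equiv> 1 - r\<^sup>2" and "m \<equiv> 2 * \<alpha> - n + 1"
  assumes rec: "(- \<alpha> - 1) * (D\<^sup>2 * G2 - 2 * (1 + r\<^sup>2) * G1 + G) = (n - 1) * ((1 + r\<^sup>2) * G1 - G)"
  shows "(- 4 * m * r\<^sup>2 + 2 * \<alpha> * r\<^sup>2) * G
      + (- 2 * m * r\<^sup>2 - \<alpha> * D) * (- \<alpha> * (G - D * G1))
      - 4 * \<alpha> * r\<^sup>2 * D * G1 + \<alpha> * D\<^sup>2 * ((- \<alpha> - 1) * (G1 - D * G2))
    = 4 * ((n - 1 - \<alpha>) * (n / 2 - \<alpha>)) * r\<^sup>2 * G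
      - (n - 2) * ((- 2 * m * r\<^sup>2 - \<alpha> * D) * G + \<alpha> * D\<^sup>2 * G1)"
proof -
  define t where "t = r\<^sup>2"
  have D: "D = 1 - t" by (simp add: D_def t_def)
  \<comment> \<open>Solving for this product, not for \<open>G2\<close>, avoids a division by
    -\<alpha> - 1.\<close>
  have E: "(- \<alpha> - 1) * D\<^sup>2 * G2 = (- \<alpha> - 1) * (2 * (1 + t) * G1 - G) + (n - 1) * ((1 + t) * G1 - G)"
    using rec unfolding t_def[symmetric] by (simp add: algebra_simps)
  have "\<alpha> * D\<^sup>2 * ((- \<alpha> - 1) * (G1 - D * G2)) = \<alpha> * D\<^sup>2 * (- \<alpha> - 1) * G1 - \<alpha> * D * ((- \<alpha> - 1) * D\<^sup>2 * G2)"
    by (simp add: power2_eq_square algebra_simps)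
  also have "\<dots> = \<alpha> * D\<^sup>2 * (- \<alpha> - 1) * G1
      - \<alpha> * D * ((- \<alpha> - 1) * (2 * (1 + t) * G1 - G) + (n - 1) * ((1 + t) * G1 - G))"
    by (simp only: E)
  finally have main: "\<alpha> * D\<^sup>2 * ((- \<alpha> - 1) * (G1 - D * G2)) = \<alpha> * D\<^sup>2 * (- \<alpha> - 1) * G1
      - \<alpha> * D * ((- \<alpha> - 1) * (2 * (1 + t) * G1 - G) + (n - 1) * ((1 + t) * G1 - G))" .
  show ?thesis
    unfolding main unfolding t_def[symmetric] m_def D
    by (simp add: power2_eq_square field_simps)
qed

text \<open>Together with the derivative of \<open>poisson_zonal\<close> this is the hypergeometric
  equation as a first-order system, with parameters a = n - 1 - \<alpha>, b = n/2 - \<alpha>, c =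
  n/2.\<close>

lemma DERIV_zonal_flux:
  fixes e :: "'a::euclidean_space"
  assumes e: "e \<in> Basis" and r: "\<bar>r\<bar> < 1" "r \<noteq> 0"
  shows "(zonal_flux e \<alpha> has_real_derivative
    (4 * ((real DIM('a) - 1 - \<alpha>) * (real DIM('a) / 2 - \<alpha>)) * r\<^sup>2 * zonal_integral e (- \<alpha>) r
      - (real DIM('a) - 2) * zonal_flux e \<alpha> r) / r) (at r)"
proof -
  define n where "n = real DIM('a)"
  define m where "m = 2 * \<alpha> - n + 1"
  let ?D = "1 - r\<^sup>2"
  let ?G = "zonal_integral e (- \<alpha>)" and ?G1 = "zonal_integral e (- \<alpha> - 1)" and ?G2 = "zonal_integral e (- \<alpha> - 2)"
  have dG: "(?G has_real_derivative - \<alpha> * (?G r - ?D * ?G1 r) / r) (at r)"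
    using DERIV_zonal_integral[OF e r, of "- \<alpha>"] .
  have dG1: "(?G1 has_real_derivative (- \<alpha> - 1) * (?G1 r - ?D * ?G2 r) / r) (at r)"
  proof -
    have "- \<alpha> - 1 - 1 = - \<alpha> - 2" by simp
    with DERIV_zonal_integral[OF e r, of "- \<alpha> - 1"] show ?thesis by (simp only:)
  qed
  have rec: "(- \<alpha> - 1) * (?D\<^sup>2 * ?G2 r - 2 * (1 + r\<^sup>2) * ?G1 r + ?G r) = (n - 1) * ((1 + r\<^sup>2) * ?G1 r - ?G r)"
    using zonal_integral_contiguous[OF e r(1), of "- \<alpha>"] by (simp add: n_def)
  define X where "X = (- 4 * m * r\<^sup>2 + 2 * \<alpha> * r\<^sup>2) * ?G r
      + (- 2 * m * r\<^sup>2 - \<alpha> * ?D) * (- \<alpha> * (?G r - ?D * ?G1 r))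
      - 4 * \<alpha> * r\<^sup>2 * ?D * ?G1 r + \<alpha> * ?D\<^sup>2 * ((- \<alpha> - 1) * (?G1 r - ?D * ?G2 r))"
  have "((\<lambda>r. (- 2 * m * r\<^sup>2 - \<alpha> * (1 - r\<^sup>2)) * ?G r + \<alpha> * (1 - r\<^sup>2)\<^sup>2 * ?G1 r) has_real_derivative
      ((- 4 * m * r + 2 * \<alpha> * r) * ?G r + (- \<alpha> * (?G r - ?D * ?G1 r) / r) * (- 2 * m * r\<^sup>2 - \<alpha> * ?D))
      + (- 4 * \<alpha> * r * ?D * ?G1 r + ((- \<alpha> - 1) * (?G1 r - ?D * ?G2 r) / r) * (\<alpha> * ?D\<^sup>2))) (at r)"
  proof (intro DERIV_add DERIV_mult dG dG1)
    show "((\<lambda>r. - 2 * m * r\<^sup>2 - \<alpha> * (1 - r\<^sup>2)) has_real_derivative - 4 * m * r + 2 * \<alpha> * r) (at r)"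
      by (auto intro!: derivative_eq_intros)
    show "((\<lambda>r. \<alpha> * (1 - r\<^sup>2)\<^sup>2) has_real_derivative - 4 * \<alpha> * r * ?D) (at r)"
      by (auto intro!: derivative_eq_intros simp: algebra_simps)
  qed
  moreover have "((- 4 * m * r + 2 * \<alpha> * r) * ?G r + (- \<alpha> * (?G r - ?D * ?G1 r) / r) * (- 2 * m * r\<^sup>2 - \<alpha> * ?D))
      + (- 4 * \<alpha> * r * ?D * ?G1 r + ((- \<alpha> - 1) * (?G1 r - ?D * ?G2 r) / r) * (\<alpha> * ?D\<^sup>2)) = X / r"
  proof -
    have id: "((- 4 * m * r + 2 * \<alpha> * r) * g + (P / r) * Q) + (- 4 * \<alpha> * r * d * g1 + (P' / r) * Q')
      = ((- 4 * m * r\<^sup>2 + 2 * \<alpha> * r\<^sup>2) * g + Q * P - 4 * \<alpha> * r\<^sup>2 * d * g1 + Q' * P') / r" for g P Q d g1 P' Q' :: real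
      using r(2) by (simp add: field_simps power2_eq_square)
    show ?thesis
      unfolding X_def by (rule id)
  qed
  moreover have "X = 4 * ((n - 1 - \<alpha>) * (n / 2 - \<alpha>)) * r\<^sup>2 * ?G r - (n - 2) * zonal_flux e \<alpha> r"
    unfolding X_def m_def zonal_flux_def n_def[symmetric]
    by (rule zonal_flux_derivative_identity[OF rec])
  ultimately show ?thesis
    by (simp only: zonal_flux_def[abs_def] m_def n_def)
qed

lemma isCont_zonal_flux:
  fixes e :: "'a::euclidean_space"
  assumes "e \<in> Basis" "\<bar>r\<bar> < 1"
  shows "isCont (zonal_flux e \<alpha>) r"
  unfolding zonal_flux_def[abs_def] by (intro continuous_intros isCont_zonal_integral assms)

lemma DERIV_poisson_zonal:
  fixes e :: "'a::euclidean_space"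
  assumes e: "e \<in> Basis" and r: "\<bar>r\<bar> < 1" "r \<noteq> 0"
  shows "(poisson_zonal e \<alpha> has_real_derivative
    (1 - r\<^sup>2) powr (2 * \<alpha> - real DIM('a)) * zonal_flux e \<alpha> r / r) (at r)"
proof -
  define m where "m = 2 * \<alpha> - real DIM('a) + 1"
  let ?D = "1 - r\<^sup>2" and ?G = "zonal_integral e (- \<alpha>) r" and ?G1 = "zonal_integral e (- \<alpha> - 1) r"
  have D: "?D powr m = ?D * ?D powr (m - 1)"
    using powr_mult_base[of ?D "m - 1"] one_minus_square_pos[OF r(1)] by simp
  have "((\<lambda>r. (1 - r\<^sup>2) powr m * zonal_integral e (- \<alpha>) r) has_real_derivative
      - 2 * r * m * ?D powr (m - 1) * ?G + (- \<alpha> * (?G - ?D * ?G1) / r) * ?D powr m) (at r)"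
    by (intro DERIV_mult DERIV_one_minus_square_powr r DERIV_zonal_integral[OF e r, of "- \<alpha>"])
  moreover have "- 2 * r * m * ?D powr (m - 1) * ?G + (- \<alpha> * (?G - ?D * ?G1) / r) * ?D powr m
      = ?D powr (m - 1) * zonal_flux e \<alpha> r / r"
  proof -
    have id: "- 2 * r * m * P * g + (- \<alpha> * (g - d * g1) / r) * (d * P)
      = P * ((- 2 * m * r\<^sup>2 - \<alpha> * d) * g + \<alpha> * d\<^sup>2 * g1) / r" for P g d g1 :: real
      using r(2) by (simp add: field_simps power2_eq_square)
    show ?thesis
      unfolding D zonal_flux_def m_def[symmetric] by (rule id)
  qed
  moreover have "m - 1 = 2 * \<alpha> - real DIM('a)"
    by (simp add: m_def)
  ultimately show ?thesis
    by (simp only: poisson_zonal_def[abs_def] m_def)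
qed

lemma isCont_poisson_zonal:
  fixes e :: "'a::euclidean_space"
  assumes "e \<in> Basis" "\<bar>r\<bar> < 1"
  shows "isCont (poisson_zonal e \<alpha>) r"
  unfolding poisson_zonal_def[abs_def] using one_minus_square_pos[OF assms(2)]
  by (intro continuous_intros isCont_zonal_integral assms) auto

lemma poisson_zonal_pos:
  fixes e :: "'a::euclidean_space"
  assumes "e \<in> Basis" "\<bar>r\<bar> < 1"
  shows "0 < poisson_zonal e \<alpha> r"
  unfolding poisson_zonal_def using one_minus_square_pos[OF assms(2)]
  by (intro mult_pos_pos zonal_integral_pos assms) auto

lemma poisson_zonal_0: "poisson_zonal e \<alpha> 0 = 1"
  by (simp add: poisson_zonal_def zonal_integral_0)

section \<open>Self-adjoint form, monotonicity and identification with the series\<close>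

lemma DERIV_power_zonal_flux:
  fixes e :: "'a::euclidean_space"
  assumes e: "e \<in> Basis" and r: "\<bar>r\<bar> < 1" "r \<noteq> 0" and n: "3 \<le> DIM('a)"
  shows "((\<lambda>r. r ^ (DIM('a) - 2) * zonal_flux e \<alpha> r) has_real_derivative
    4 * ((real DIM('a) - 1 - \<alpha>) * (real DIM('a) / 2 - \<alpha>)) * r ^ (DIM('a) - 1) * zonal_integral e (- \<alpha>) r) (at r)"
proof -
  obtain k where k: "DIM('a) = k + 3"
    using n by (metis add.commute le_add_diff_inverse)
  \<comment> \<open>The power r^(n - 2) = r^(k + 1) is an integrating factor: it absorbs the term
    with n - 2 in the derivative of the flux.\<close>
  have "((\<lambda>r. r ^ (k + 1) * zonal_flux e \<alpha> r) has_real_derivative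
      real (k + 1) * r ^ k * zonal_flux e \<alpha> r
      + ((4 * ((real DIM('a) - 1 - \<alpha>) * (real DIM('a) / 2 - \<alpha>)) * r\<^sup>2 * zonal_integral e (- \<alpha>) r
      - (real DIM('a) - 2) * zonal_flux e \<alpha> r) / r) * r ^ (k + 1)) (at r)"
    using DERIV_pow[of "k + 1" r] by (intro DERIV_mult DERIV_zonal_flux e r) simp
  also have "real (k + 1) * r ^ k * zonal_flux e \<alpha> r
      + ((4 * ((real DIM('a) - 1 - \<alpha>) * (real DIM('a) / 2 - \<alpha>)) * r\<^sup>2 * zonal_integral e (- \<alpha>) r
      - (real DIM('a) - 2) * zonal_flux e \<alpha> r) / r) * r ^ (k + 1)
    = 4 * ((real DIM('a) - 1 - \<alpha>) * (real DIM('a) / 2 - \<alpha>)) * r ^ (k + 2) * zonal_integral e (- \<alpha>) r"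
  proof -
    have id: "(j + 1) * p * x + ((q * r\<^sup>2 * g - (j + 1) * x) / r) * (p * r) = q * (p * r * r) * g" for j p x q g :: real
      using r(2) by (simp add: field_simps power2_eq_square)
    have "real DIM('a) - 2 = real k + 1" "real (k + 1) = real k + 1" "r ^ (k + 1) = r ^ k * r" "r ^ (k + 2) = r ^ k * r * r"
      by (simp_all add: k)
    then show ?thesis by (simp only: id)
  qed
  finally show ?thesis
    by (simp add: k)
qed

text \<open>The product of r^(n - 2) and the flux vanishes at 0 and has a nonnegative derivative:
  for \<alpha> \<ge> n - 1 both n - 1 - \<alpha> and n/2 - \<alpha> are nonpositive, and zonal
  integrals are positive.\<close>

lemma zonal_flux_nonneg:
  fixes e :: "'a::euclidean_space"
  assumes e: "e \<in> Basis" and n: "3 \<le> DIM('a)" and r: "0 < r" "r < 1" and \<alpha>: "real DIM('a) - 1 \<le> \<alpha>"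
  shows "0 \<le> zonal_flux e \<alpha> r"
proof -
  let ?V = "\<lambda>r. r ^ (DIM('a) - 2) * zonal_flux e \<alpha> r"
  have "?V 0 \<le> ?V r"
  proof (rule DERIV_nonneg_imp_increasing_open[where f = ?V])
    fix s assume s: "0 < s" "s < r"
    then have "\<bar>s\<bar> < 1" using r by simp
    have "0 \<le> (real DIM('a) - 1 - \<alpha>) * (real DIM('a) / 2 - \<alpha>)"
      using \<alpha> n by (intro mult_nonpos_nonpos) auto
    moreover have "0 \<le> 4 * q * s ^ (DIM('a) - 1) * zonal_integral e (- \<alpha>) s" if "0 \<le> q" for q
      using that s zonal_integral_pos[OF e \<open>\<bar>s\<bar> < 1\<close>, of "- \<alpha>"] by simp
    ultimately have "0 \<le> 4 * ((real DIM('a) - 1 - \<alpha>) * (real DIM('a) / 2 - \<alpha>)) * s ^ (DIM('a) - 1) * zonal_integral e (- \<alpha>) s"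
      by blast
    then show "\<exists>y. (?V has_real_derivative y) (at s) \<and> 0 \<le> y"
      using DERIV_power_zonal_flux[OF e \<open>\<bar>s\<bar> < 1\<close> _ n] s by blast
  next
    show "continuous_on {0..r} ?V"
      using r by (intro continuous_at_imp_continuous_on ballI continuous_intros isCont_zonal_flux e) auto
  qed (use r in auto)
  moreover have "?V 0 = 0" using n by (simp add: power_0_left)
  ultimately have "r ^ (DIM('a) - 2) * 0 \<le> r ^ (DIM('a) - 2) * zonal_flux e \<alpha> r"
    by simp
  then show ?thesis
    by (rule mult_left_le_imp_le) (use r in simp)
qed

lemma poisson_zonal_mono:
  fixes e :: "'a::euclidean_space"
  assumes e: "e \<in> Basis" and n: "3 \<le> DIM('a)" and \<alpha>: "real DIM('a) - 1 \<le> \<alpha>" and rs: "0 \<le> r" "r \<le> s" "s < 1"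
  shows "poisson_zonal e \<alpha> r \<le> poisson_zonal e \<alpha> s"
proof (rule DERIV_nonneg_imp_increasing_open[OF rs(2), where f = "poisson_zonal e \<alpha>"])
  fix t assume t: "r < t" "t < s"
  then have "\<bar>t\<bar> < 1" "t \<noteq> 0" "0 < t" using rs by auto
  then have "0 \<le> (1 - t\<^sup>2) powr (2 * \<alpha> - real DIM('a)) * zonal_flux e \<alpha> t / t"
    using zonal_flux_nonneg[OF e n _ _ \<alpha>, of t] by simp
  then show "\<exists>y. (poisson_zonal e \<alpha> has_real_derivative y) (at t) \<and> 0 \<le> y"
    using DERIV_poisson_zonal[OF e \<open>\<bar>t\<bar> < 1\<close> \<open>t \<noteq> 0\<close>] by blast
next
  show "continuous_on {r..s} (poisson_zonal e \<alpha>)"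
    using rs by (intro continuous_at_imp_continuous_on ballI isCont_poisson_zonal e) auto
qed

text \<open>Both functions of \<open>t = r\<^sup>2\<close> solve the hypergeometric equation
  \<open>(t powr c * (1 - t) powr (a + b - c + 1) * y')' = a b t powr (c - 1) * (1 - t) powr (a + b - c) * y\<close>.
  Their Wronskian is constant and vanishes at \<open>0\<close>, and both functions have the value \<open>1\<close> there.\<close>

lemma poisson_zonal_eq_hypergeo_2F1:
  fixes e :: "'a::euclidean_space"
  assumes e: "e \<in> Basis" and n: "3 \<le> DIM('a)" and \<alpha>: "real DIM('a) - 1 < 2 * \<alpha>" and r: "0 \<le> r" "r < 1"
  shows "poisson_zonal e \<alpha> r =
    hypergeo_2F1 (real DIM('a) - 1 - \<alpha>) (real DIM('a) / 2 - \<alpha>) (real DIM('a) / 2) (r\<^sup>2)"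
proof -
  \<comment> \<open>Here c - a - b is the \<open>m\<close> defined next, so the hypothesis on
    \<open>\<alpha>\<close> is the condition for convergence at 1.\<close>
  define a b c where "a = real DIM('a) - 1 - \<alpha>" and "b = real DIM('a) / 2 - \<alpha>" and "c = real DIM('a) / 2"
  define m where "m = 2 * \<alpha> - real DIM('a) + 1"
  obtain k where k: "DIM('a) = k + 3"
    using n by (metis add.commute le_add_diff_inverse)
  have c: "c > 0" "c - a - b > 0"
    using \<alpha> by (simp_all add: a_def b_def c_def)
  define F F1 F2 where "F = eval_fps (fps_2F1 a b c)" and "F1 = eval_fps (fps_deriv (fps_2F1 a b c))"
    and "F2 = eval_fps (fps_deriv (fps_deriv (fps_2F1 a b c)))"
  define \<Psi> where "\<Psi> = poisson_zonal e \<alpha>"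
  define J where "J = zonal_flux e \<alpha>"
  define G where "G = zonal_integral e (- \<alpha>)"
  \<comment> \<open>For s \<noteq> 0, \<open>V\<close> and \<open>2 * VF\<close> are s^(n - 1) (1 -
    s^2)^(1 - m) times the derivatives of \<Psi>(s) and of F(s^2), so \<open>W\<close> is the
    weighted Wronskian. Expressing \<open>V\<close> by \<open>J\<close> clears the factor 1/s and
    makes it continuous at 0.\<close>
  define V where "V s = s ^ (k + 1) * J s" for s
  define VF where "VF s = s ^ (k + 3) * ((1 - s\<^sup>2) powr (1 - m) * F1 (s\<^sup>2))" for s
  define W where "W s = F (s\<^sup>2) * V s - 2 * (\<Psi> s * VF s)" for s
  have sq: "\<bar>s\<^sup>2\<bar> < 1" if "\<bar>s\<bar> < 1" for s :: real
    using that by (simp add: abs_square_less_1)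
  have dF: "((\<lambda>s. F (s\<^sup>2)) has_real_derivative F1 (s\<^sup>2) * (2 * s)) (at s)"
    and dF1: "((\<lambda>s. F1 (s\<^sup>2)) has_real_derivative F2 (s\<^sup>2) * (2 * s)) (at s)" if "\<bar>s\<bar> < 1" for s
  proof -
    have "((\<lambda>s. s\<^sup>2) has_real_derivative 2 * s) (at s)"
      by (auto intro!: derivative_eq_intros)
    then show "((\<lambda>s. F (s\<^sup>2)) has_real_derivative F1 (s\<^sup>2) * (2 * s)) (at s)"
      "((\<lambda>s. F1 (s\<^sup>2)) has_real_derivative F2 (s\<^sup>2) * (2 * s)) (at s)"
      using DERIV_eval_fps_2F1[OF c sq[OF that]] unfolding F_def F1_def F2_def
      by (auto intro: DERIV_chain2)
  qed
  have dV: "(V has_real_derivative 4 * (a * b) * s ^ (k + 2) * G s) (at s)" if "\<bar>s\<bar> < 1" "s \<noteq> 0" for s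
    using DERIV_power_zonal_flux[OF e that n, of \<alpha>]
    unfolding V_def[abs_def] J_def G_def a_def b_def k by simp
  \<comment> \<open>Since \<open>\<Psi>\<close> is (1 - s^2)^m times \<open>G\<close>, the functions
    \<open>V\<close> and \<open>2 * VF\<close> satisfy the same equation, which makes the Wronskian
    constant.\<close>
  have dVF: "(VF has_real_derivative 2 * (a * b) * s ^ (k + 2) * ((1 - s\<^sup>2) powr (- m) * F (s\<^sup>2))) (at s)"
    if s: "\<bar>s\<bar> < 1" for s
  proof -
    have D: "(1 - s\<^sup>2) powr (1 - m) = (1 - s\<^sup>2) * (1 - s\<^sup>2) powr (- m)"
      using powr_mult_base[of "1 - s\<^sup>2" "- m"] one_minus_square_pos[OF s] by simp
    have ode: "s\<^sup>2 * (1 - s\<^sup>2) * F2 (s\<^sup>2) + (c - (a + b + 1) * s\<^sup>2) * F1 (s\<^sup>2) = a * b * F (s\<^sup>2)"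
      using eval_fps_2F1_ode[OF c sq[OF s]] by (simp add: F_def F1_def F2_def)
    have "(VF has_real_derivative real (k + 3) * s ^ (k + 2) * ((1 - s\<^sup>2) powr (1 - m) * F1 (s\<^sup>2))
      + (- 2 * s * (1 - m) * (1 - s\<^sup>2) powr (1 - m - 1) * F1 (s\<^sup>2)
        + F2 (s\<^sup>2) * (2 * s) * (1 - s\<^sup>2) powr (1 - m)) * s ^ (k + 3)) (at s)"
      unfolding VF_def[abs_def] using DERIV_pow[of "k + 3" s]
      by (intro DERIV_mult DERIV_one_minus_square_powr dF1 s) (simp add: eval_nat_numeral)
    moreover have "real (k + 3) * s ^ (k + 2) * ((1 - s\<^sup>2) powr (1 - m) * F1 (s\<^sup>2))
      + (- 2 * s * (1 - m) * (1 - s\<^sup>2) powr (1 - m - 1) * F1 (s\<^sup>2)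
        + F2 (s\<^sup>2) * (2 * s) * (1 - s\<^sup>2) powr (1 - m)) * s ^ (k + 3)
      = 2 * s ^ (k + 2) * (1 - s\<^sup>2) powr (- m)
        * (s\<^sup>2 * (1 - s\<^sup>2) * F2 (s\<^sup>2) + (c - (a + b + 1) * s\<^sup>2) * F1 (s\<^sup>2))"
    proof -
      have id: "2 * c * p * (((1 - s\<^sup>2) * P) * f1)
        + (- 2 * s * (1 - (c - a - b)) * P * f1 + f2 * (2 * s) * ((1 - s\<^sup>2) * P)) * (p * s)
        = 2 * p * P * (s\<^sup>2 * (1 - s\<^sup>2) * f2 + (c - (a + b + 1) * s\<^sup>2) * f1)" for p P f1 f2
        by (simp add: power2_eq_square algebra_simps)
      have eqs: "real (k + 3) = 2 * c" "1 - m = 1 - (c - a - b)" "s ^ (k + 3) = s ^ (k + 2) * s" "1 - m - 1 = - m"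
        using k by (simp_all add: c_def m_def a_def b_def eval_nat_numeral)
      show ?thesis
        unfolding eqs(4) D unfolding eqs(1,2,3) by (rule id)
    qed
    ultimately show ?thesis
      unfolding ode by (simp add: mult_ac)
  qed
  have d\<Psi>: "(\<Psi> has_real_derivative (1 - s\<^sup>2) powr (m - 1) * J s / s) (at s)" if "\<bar>s\<bar> < 1" "s \<noteq> 0" for s
    using DERIV_poisson_zonal[OF e that, of \<alpha>] by (simp add: \<Psi>_def m_def J_def)
  have \<Psi>: "\<Psi> s = (1 - s\<^sup>2) powr m * G s" for s
    by (simp add: \<Psi>_def poisson_zonal_def m_def G_def)
  have cont: "isCont \<Psi> s" "isCont V s" "isCont VF s" "isCont (\<lambda>s. F (s\<^sup>2)) s" "isCont W s" if s: "\<bar>s\<bar> < 1" for s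
  proof -
    show \<Psi>: "isCont \<Psi> s"
      unfolding \<Psi>_def by (rule isCont_poisson_zonal[OF e s])
    show V: "isCont V s"
      unfolding V_def[abs_def] J_def by (intro continuous_intros isCont_zonal_flux e s)
    show VF: "isCont VF s"
      using dVF[OF s] by (rule DERIV_isCont)
    show F: "isCont (\<lambda>s. F (s\<^sup>2)) s"
      using dF[OF s] by (rule DERIV_isCont)
    show "isCont W s"
      unfolding W_def[abs_def] by (intro continuous_intros \<Psi> V VF F)
  qed
  \<comment> \<open>\<open>W\<close> is constant on [0, s], and the positive powers of s in
    \<open>V\<close> and \<open>VF\<close> make it vanish at 0.\<close>
  have W0: "W s = 0" if s: "0 < s" "s < 1" for s
  proof -
    have "W s = W 0"
    proof (rule DERIV_isconst_end[where f = W])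
      show "continuous_on {0..s} W"
        using s by (intro continuous_at_imp_continuous_on ballI cont) auto
      fix x assume x: "0 < x" "x < s"
      then have x1: "\<bar>x\<bar> < 1" "x \<noteq> 0" using s by auto
      have P: "(1 - x\<^sup>2) powr m * (1 - x\<^sup>2) powr (- m) = 1" "(1 - x\<^sup>2) powr (m - 1) * (1 - x\<^sup>2) powr (1 - m) = 1"
        using one_minus_square_pos[OF x1(1)] by (simp_all add: powr_add[symmetric])
      have "(W has_real_derivative (F1 (x\<^sup>2) * (2 * x) * V x + 4 * (a * b) * x ^ (k + 2) * G x * F (x\<^sup>2))
        - 2 * ((1 - x\<^sup>2) powr (m - 1) * J x / x * VF x
          + 2 * (a * b) * x ^ (k + 2) * ((1 - x\<^sup>2) powr (- m) * F (x\<^sup>2)) * \<Psi> x)) (at x)"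
        unfolding W_def[abs_def] using x1 by (intro DERIV_diff DERIV_cmult DERIV_mult dF dV dVF d\<Psi>)
      moreover have "(F1 (x\<^sup>2) * (2 * x) * V x + 4 * (a * b) * x ^ (k + 2) * G x * F (x\<^sup>2))
        - 2 * ((1 - x\<^sup>2) powr (m - 1) * J x / x * VF x
          + 2 * (a * b) * x ^ (k + 2) * ((1 - x\<^sup>2) powr (- m) * F (x\<^sup>2)) * \<Psi> x) = 0"
      proof -
        have id: "(f1 * (2 * x) * (p * x * j) + 4 * q * (p * x * x) * g * f)
          - 2 * (A * j / x * (p * x * x * x * (B * f1)) + 2 * q * (p * x * x) * (C * f) * (E * g)) = 0"
          if "A * B = 1" "E * C = 1" for f f1 p j q g A B C E
        proof -
          have eqs: "A * j / x * (p * x * x * x * (B * f1)) = (A * B) * (j * p * x * x * f1)"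
            "2 * q * (p * x * x) * (C * f) * (E * g) = (E * C) * (2 * q * p * x * x * f * g)"
            using x1(2) by (simp_all add: field_simps)
          show ?thesis unfolding eqs that by (simp add: algebra_simps)
        qed
        have "x ^ (k + 1) = x ^ k * x" "x ^ (k + 2) = x ^ k * x * x" "x ^ (k + 3) = x ^ k * x * x * x"
          by (simp_all add: power_add eval_nat_numeral)
        then show ?thesis
          unfolding V_def VF_def \<Psi> using id[OF P(2) P(1)] by (simp only:)
      qed
      ultimately show "(W has_real_derivative 0) (at x)" by simp
    qed (use s in simp)
    also have "W 0 = 0" by (simp add: W_def V_def VF_def)
    finally show ?thesis .
  qed
  have pos: "0 < \<Psi> s" if "\<bar>s\<bar> < 1" for s
    unfolding \<Psi>_def by (rule poisson_zonal_pos[OF e that])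
  have zero: "F (0\<^sup>2) / \<Psi> 0 = 1"
    by (simp add: F_def eval_fps_at_0 fps_2F1_nth \<Psi>_def poisson_zonal_0)
  \<comment> \<open>As the Wronskian vanishes, the quotient has derivative 0, so it keeps its value
    at 0; positivity of \<open>\<Psi>\<close> allows the division.\<close>
  have "F (r\<^sup>2) / \<Psi> r = 1"
  proof (cases "r = 0")
    case False
    have "F (r\<^sup>2) / \<Psi> r = F (0\<^sup>2) / \<Psi> 0"
    proof (rule DERIV_isconst_end[where f = "\<lambda>r. F (r\<^sup>2) / \<Psi> r"])
      show "continuous_on {0..r} (\<lambda>r. F (r\<^sup>2) / \<Psi> r)"
        using r pos by (intro continuous_at_imp_continuous_on ballI continuous_intros cont) (auto simp: less_imp_neq[symmetric])
      fix x assume x: "0 < x" "x < r"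
      then have x1: "\<bar>x\<bar> < 1" "x \<noteq> 0" using r by auto
      have P: "(1 - x\<^sup>2) powr (m - 1) * (1 - x\<^sup>2) powr (1 - m) = 1"
        using one_minus_square_pos[OF x1(1)] by (simp add: powr_add[symmetric])
      have "F1 (x\<^sup>2) * (2 * x) * \<Psi> x - F (x\<^sup>2) * ((1 - x\<^sup>2) powr (m - 1) * J x / x) = 0"
      proof -
        have id: "f1 * (2 * x) * y - f * (A * j / x) = 0"
          if "A * B = 1" "f * (p * x * j) - 2 * (y * (p * x * x * x * (B * f1))) = 0" "p \<noteq> 0" for f f1 y A B p j
        proof -
          have "p * x * (f * j) = p * x * (2 * y * x * x * B * f1)"
            using that(2) by (simp add: algebra_simps)
          then have "f * j = 2 * y * x * x * B * f1"
            using that(3) x1(2) by simp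
          then have "f * (A * j / x) = A * (2 * y * x * x * B * f1) / x"
            by (simp add: mult_ac)
          also have "\<dots> = (A * B) * (2 * y * x * f1)"
            using x1(2) by simp
          finally show ?thesis unfolding that(1) by simp
        qed
        have "x ^ (k + 1) = x ^ k * x" "x ^ (k + 3) = x ^ k * x * x * x"
          by (simp_all add: power_add eval_nat_numeral)
        then have "F (x\<^sup>2) * (x ^ k * x * J x)
            - 2 * (\<Psi> x * (x ^ k * x * x * x * ((1 - x\<^sup>2) powr (1 - m) * F1 (x\<^sup>2)))) = 0"
          using W0[of x] x r unfolding W_def V_def VF_def by (simp only:)
        from id[OF P this] show ?thesis using x1 by simp
      qed
      moreover have "((\<lambda>r. F (r\<^sup>2) / \<Psi> r) has_real_derivative
        (F1 (x\<^sup>2) * (2 * x) * \<Psi> x - F (x\<^sup>2) * ((1 - x\<^sup>2) powr (m - 1) * J x / x)) / (\<Psi> x * \<Psi> x)) (at x)"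
        using pos[OF x1(1)] x1 by (intro DERIV_divide dF d\<Psi>) auto
      ultimately show "((\<lambda>r. F (r\<^sup>2) / \<Psi> r) has_real_derivative 0) (at x)"
        by (simp only: div_0)
    qed (use r False in simp)
    then show ?thesis by (simp only: zero)
  next
    case True
    then show ?thesis by (simp only: zero)
  qed
  then have "\<Psi> r = F (r\<^sup>2)"
    using pos[of r] r by (simp add: field_simps)
  then show ?thesis
    by (simp add: \<Psi>_def F_def eval_fps_2F1 a_def b_def c_def)
qed

text \<open>Continuity of the series at 1 gives the limit, and monotonicity in r keeps every value
  below it.\<close>

lemma
  fixes e :: "'a::euclidean_space"
  assumes e: "e \<in> Basis" and n: "3 \<le> DIM('a)" and \<alpha>: "real DIM('a) - 1 \<le> \<alpha>"
  shows tendsto_poisson_zonal: "(poisson_zonal e \<alpha> \<longlongrightarrow>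
      hypergeo_2F1 (real DIM('a) - 1 - \<alpha>) (real DIM('a) / 2 - \<alpha>) (real DIM('a) / 2) 1) (at_left 1)"
    and poisson_zonal_le: "0 \<le> r \<Longrightarrow> r < 1 \<Longrightarrow> poisson_zonal e \<alpha> r
      \<le> hypergeo_2F1 (real DIM('a) - 1 - \<alpha>) (real DIM('a) / 2 - \<alpha>) (real DIM('a) / 2) 1"
proof -
  define F where "F = hypergeo_2F1 (real DIM('a) - 1 - \<alpha>) (real DIM('a) / 2 - \<alpha>) (real DIM('a) / 2)"
  have eq: "poisson_zonal e \<alpha> s = F (s\<^sup>2)" if "0 \<le> s" "s < 1" for s
    unfolding F_def using \<alpha> n that by (intro poisson_zonal_eq_hypergeo_2F1 e) auto
  have "continuous_on {0..1} F"
    unfolding F_def using \<alpha> n by (intro continuous_on_hypergeo_2F1) auto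
  then have "continuous_on {0..1} (\<lambda>s. F (s\<^sup>2))"
    by (rule continuous_on_compose2) (auto intro!: continuous_intros simp: power_le_one)
  then have "((\<lambda>s. F (s\<^sup>2)) \<longlongrightarrow> F (1\<^sup>2)) (at_left 1)"
    by (intro continuous_on_Icc_at_leftD) auto
  moreover have "\<forall>\<^sub>F s in at_left 1. F (s\<^sup>2) = poisson_zonal e \<alpha> s"
    using eventually_at_left_real[of 0 1] by (auto elim!: eventually_mono simp: eq)
  ultimately show lim: "(poisson_zonal e \<alpha> \<longlongrightarrow> F 1) (at_left 1)"
    by (simp add: Lim_transform_eventually)
  assume r: "0 \<le> r" "r < 1"
  show "poisson_zonal e \<alpha> r \<le> F 1"
  proof (rule tendsto_lowerbound[OF lim])
    show "\<forall>\<^sub>F s in at_left 1. poisson_zonal e \<alpha> r \<le> poisson_zonal e \<alpha> s"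
      using eventually_at_left_real[OF r(2)]
      by eventually_elim (use r in \<open>auto intro!: poisson_zonal_mono[OF e n \<alpha>]\<close>)
  qed simp
qed

subsection \<open>The Poisson-Szego kernel\<close>

text \<open>Young's inequality for the factors divided by their norms, then integrated; the same
  bound gives integrability of the product. If a norm is 0, the product vanishes almost
  everywhere.\<close>

lemma Holder_integral:
  fixes f g :: "'a \<Rightarrow> real" and p q :: real
  assumes p: "1 < p" and q: "1 < q" and pq: "1 / p + 1 / q = 1"
    and meas [measurable]: "f \<in> borel_measurable M" "g \<in> borel_measurable M"
    and nonneg: "\<And>x. 0 \<le> f x" "\<And>x. 0 \<le> g x"
    and int: "integrable M (\<lambda>x. f x powr p)" "integrable M (\<lambda>x. g x powr q)"
  shows "(\<integral>x. f x * g x \<partial>M) \<le> (\<integral>x. f x powr p \<partial>M) powr (1 / p) * (\<integral>x. g x powr q \<partial>M) powr (1 / q)"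
proof -
  define A B where "A = (\<integral>x. f x powr p \<partial>M)" and "B = (\<integral>x. g x powr q \<partial>M)"
  have AB: "0 \<le> A" "0 \<le> B" by (simp_all add: A_def B_def)
  show ?thesis
  proof (cases "A = 0 \<or> B = 0")
    case True
    then have "(AE x in M. f x powr p = 0) \<or> (AE x in M. g x powr q = 0)"
      unfolding A_def B_def using int by (simp add: integral_nonneg_eq_0_iff_AE)
    then have "AE x in M. f x * g x = 0" by auto
    then have "(\<integral>x. f x * g x \<partial>M) = 0"
      by (rule integral_eq_zero_AE)
    then show ?thesis by simp
  next
    case False
    with AB have pos: "0 < A" "0 < B" by auto
    define a b where "a = A powr (1 / p)" and "b = B powr (1 / q)"
    have ab: "0 < a" "0 < b" "a powr p = A" "b powr q = B"
      using pos p q by (simp_all add: a_def b_def powr_powr)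
    have bound: "f x * g x \<le> a * b * (f x powr p / (A * p) + g x powr q / (B * q))" for x
    proof -
      have "f x / a * (g x / b) \<le> (f x / a) powr p / p + (g x / b) powr q / q"
        using p q pq nonneg ab by (intro Youngs_inequality) auto
      then have "f x * g x / (a * b) \<le> f x powr p / (A * p) + g x powr q / (B * q)"
        using ab nonneg by (simp add: powr_divide)
      then show ?thesis
        using ab by (simp add: divide_le_eq mult.commute)
    qed
    have rint: "integrable M (\<lambda>x. a * b * (f x powr p / (A * p) + g x powr q / (B * q)))"
      using int by auto
    have "integrable M (\<lambda>x. f x * g x)"
      using rint by (rule Bochner_Integration.integrable_bound)
        (use bound nonneg in \<open>auto intro!: AE_I2 order_trans[OF bound]\<close>)
    then have "(\<integral>x. f x * g x \<partial>M) \<le> (\<integral>x. a * b * (f x powr p / (A * p) + g x powr q / (B * q)) \<partial>M)"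
      using rint bound by (rule integral_mono)
    also have "\<dots> = a * b * (A / (A * p) + B / (B * q))"
      using int by (simp add: A_def B_def)
    also have "\<dots> = a * b"
      using pos pq by simp
    finally show ?thesis by (simp add: a_def b_def A_def B_def)
  qed
qed

text \<open>Replaces arithmetic in \<open>ennreal\<close> by real conjugate exponents; an infinite
  \<open>p\<close> leaves only \<open>q = 1\<close>.\<close>

lemma conjugate_exponent_cases:
  fixes p :: ennreal and q :: real
  assumes "1 < p" "1 \<le> q" "1 / p + 1 / ennreal q = 1"
  obtains "p = \<infinity>" "q = 1"
  | "p \<noteq> \<infinity>" "1 < enn2real p" "1 < q" "1 / enn2real p + 1 / q = 1" "enn2real (1 / p) = 1 / enn2real p"
proof (cases p)
  case (real P)
  then have P: "1 < P" using assms(1) by simp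
  have "ennreal (1 / P + 1 / q) = 1"
    using assms P real by (simp add: ennreal_plus divide_ennreal flip: ennreal_1)
  then have "1 / P + 1 / q = 1"
    by (simp only: ennreal_eq_1)
  moreover from this have "1 < q"
    using P assms(2) by (cases "q = 1") auto
  moreover have "enn2real (1 / p) = 1 / P"
    using P real by (simp add: divide_ennreal flip: ennreal_1)
  ultimately show ?thesis
    using P real that(2) by simp
next
  case top
  then have "1 / ennreal q = 1" using assms(3) by simp
  then have "ennreal (1 / q) = 1"
    using assms(2) divide_ennreal[of 1 q] by simp
  then have "1 / q = 1" by (simp only: ennreal_eq_1)
  then show ?thesis using top that(1) by simp
qed

lemma Holder_Lp_norm:
  fixes \<phi> :: "'a \<Rightarrow> 'b::euclidean_space" and g :: "'a \<Rightarrow> real"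
  assumes pq: "1 < p" "1 \<le> q" "1 / p + 1 / ennreal q = 1"
    and \<phi>: "\<phi> \<in> Lp_space p M"
    and g [measurable]: "g \<in> borel_measurable M" and nonneg: "\<And>x. 0 \<le> g x" and int: "integrable M (\<lambda>x. g x powr q)"
  shows "(\<integral>x. g x * norm (\<phi> x) \<partial>M) \<le> (\<integral>x. g x powr q \<partial>M) powr (1 / q) * Lp_norm p M \<phi>"
  using pq
proof (cases rule: conjugate_exponent_cases)
  case 1
  have [measurable]: "\<phi> \<in> borel_measurable M" and fin: "esssup M (\<lambda>x. ennreal (norm (\<phi> x))) < \<infinity>"
    using \<phi> 1 by (auto simp: Lp_space_def)
  \<comment> \<open>Membership in \<open>Lp_space\<close> makes the essential supremum finite, so
    \<open>enn2real\<close> does not collapse it to 0.\<close>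
  define B where "B = enn2real (esssup M (\<lambda>x. ennreal (norm (\<phi> x))))"
  have B: "AE x in M. norm (\<phi> x) \<le> B"
    using esssup_AE[where M = M and f = "\<lambda>x. ennreal (norm (\<phi> x))"]
  proof eventually_elim
    case (elim x)
    then have "ennreal (norm (\<phi> x)) \<le> ennreal B"
      using fin by (simp add: B_def)
    then show ?case by (simp add: B_def)
  qed
  have gint: "integrable M g"
    using int nonneg 1 by simp
  then have Bint: "integrable M (\<lambda>x. g x * B)" by simp
  have le: "AE x in M. g x * norm (\<phi> x) \<le> g x * B"
    using B by eventually_elim (simp add: mult_left_mono nonneg)
  have "(\<integral>x. g x * norm (\<phi> x) \<partial>M) \<le> (\<integral>x. g x * B \<partial>M)"
    using Bint le by (rule integral_mono_AE') (simp add: nonneg B_def)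
  also have "\<dots> = (\<integral>x. g x powr q \<partial>M) powr (1 / q) * Lp_norm p M \<phi>"
    using 1 nonneg by (simp add: Lp_norm_def B_def)
  finally show ?thesis .
next
  case 2
  have "\<phi> \<in> borel_measurable M" "integrable M (\<lambda>x. norm (\<phi> x) powr enn2real p)"
    using \<phi> 2 by (auto simp: Lp_space_def)
  then have "(\<integral>x. g x * norm (\<phi> x) \<partial>M)
      \<le> (\<integral>x. g x powr q \<partial>M) powr (1 / q) * (\<integral>x. norm (\<phi> x) powr enn2real p \<partial>M) powr (1 / enn2real p)"
    using 2 int nonneg by (intro Holder_integral) auto
  then show ?thesis
    using 2 by (simp add: Lp_norm_def)
qed

section \<open>Powers of the kernel and their means over the sphere\<close>

lemma poisson_szego_kernel_powr:
  fixes x z :: "real ^ 'n"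
  assumes "norm x < 1" "norm z = 1"
  shows "poisson_szego_kernel x z powr q
    = (1 - (norm x)\<^sup>2) powr ((real CARD('n) - 1) * q) * (1 + (norm x)\<^sup>2 - 2 * (z \<bullet> x)) powr (- ((real CARD('n) - 1) * q))"
proof -
  have D: "0 < 1 - (norm x)\<^sup>2"
    using one_minus_square_pos[of "norm x"] assms by simp
  have eq: "(norm (x - z))\<^sup>2 = 1 + (norm x)\<^sup>2 - 2 * (z \<bullet> x)"
    using assms(2) by (simp add: power2_norm_eq_inner norm_eq_1 inner_simps inner_commute[of x z])
  have "x \<noteq> z" using assms by auto
  then have Q: "0 < (norm (x - z))\<^sup>2" by simp
  have N: "real (CARD('n) - 1) = real CARD('n) - 1"
    using one_le_card_finite[where 'a='n] by (simp add: of_nat_diff)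
  have "poisson_szego_kernel x z = ((1 - (norm x)\<^sup>2) / (norm (x - z))\<^sup>2) powr (real CARD('n) - 1)"
    unfolding poisson_szego_kernel_def N[symmetric] using D Q by (subst powr_realpow) auto
  then have "poisson_szego_kernel x z powr q = ((1 - (norm x)\<^sup>2) / (norm (x - z))\<^sup>2) powr ((real CARD('n) - 1) * q)"
    by (simp add: powr_powr)
  also have "\<dots> = (1 - (norm x)\<^sup>2) powr ((real CARD('n) - 1) * q) * (norm (x - z))\<^sup>2 powr (- ((real CARD('n) - 1) * q))"
    using D Q by (simp add: powr_divide powr_minus_divide)
  finally show ?thesis unfolding eq .
qed

lemma poisson_szego_kernel_nonneg: "norm x \<le> 1 \<Longrightarrow> 0 \<le> poisson_szego_kernel x z"
  by (simp add: poisson_szego_kernel_def power_le_one)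

lemma poisson_szego_kernel_pos:
  assumes "norm x < 1" "norm z = 1"
  shows "0 < poisson_szego_kernel x z"
proof -
  have "x \<noteq> z" using assms by auto
  then show ?thesis
    unfolding poisson_szego_kernel_def using one_minus_square_pos[of "norm x"] assms
    by (intro zero_less_power divide_pos_pos) auto
qed

lemma borel_measurable_poisson_szego_kernel [measurable]:
  "poisson_szego_kernel x \<in> borel_measurable borel"
  unfolding poisson_szego_kernel_def[abs_def] by measurable

lemma integrable_poisson_szego_kernel_powr:
  fixes x :: "real ^ 'n"
  assumes "norm x < 1"
  shows "integrable sphere_measure (\<lambda>z. poisson_szego_kernel x z powr q)"
proof (intro integrable_sphere_measure_continuous continuous_on_powr ballI)
  show "continuous_on (sphere 0 1) (poisson_szego_kernel x)"
    unfolding poisson_szego_kernel_def[abs_def] using assms by (intro continuous_intros) auto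
  show "poisson_szego_kernel x z \<noteq> 0" if "z \<in> sphere 0 1" for z
    using poisson_szego_kernel_pos[OF assms, of z] that by simp
qed simp

text \<open>Rotation invariance allows \<open>x\<close> to be replaced by |x| e, after which the
  integral is zonal.\<close>

lemma integral_poisson_szego_kernel_powr:
  fixes x e :: "real ^ 'n"
  assumes x: "norm x < 1" and e: "e \<in> Basis"
  shows "(\<integral>z. poisson_szego_kernel x z powr q \<partial>sphere_measure)
    = (1 - (norm x)\<^sup>2) powr (- ((real CARD('n) - 1) * (q - 1))) * poisson_zonal e ((real CARD('n) - 1) * q) (norm x)"
proof -
  let ?r = "norm x" and ?\<alpha> = "(real CARD('n) - 1) * q"
  let ?g = "\<lambda>z. (1 + ?r\<^sup>2 - 2 * (z \<bullet> x)) powr (- ?\<alpha>)"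
  have "norm (?r *\<^sub>R e) = norm x" using e by simp
  then obtain U where U: "orthogonal_transformation U" "U (?r *\<^sub>R e) = x"
    using orthogonal_transformation_exists by blast
  have "(\<integral>z. poisson_szego_kernel x z powr q \<partial>sphere_measure) = (\<integral>z. (1 - ?r\<^sup>2) powr ?\<alpha> * ?g z \<partial>sphere_measure)"
    by (rule Bochner_Integration.integral_cong[OF refl])
      (simp add: poisson_szego_kernel_powr[OF x] space_sphere_measure)
  also have "\<dots> = (1 - ?r\<^sup>2) powr ?\<alpha> * (\<integral>z. ?g z \<partial>sphere_measure)"
    by simp
  also have "(\<integral>z. ?g z \<partial>sphere_measure) = (\<integral>z. ?g (U z) \<partial>sphere_measure)"
    by (rule integral_sphere_measure_orthogonal_transformation[symmetric, OF U(1)]) measurable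
  also have "\<dots> = zonal_integral e (- ?\<alpha>) ?r"
  proof -
    have "U z \<bullet> x = ?r * (z \<bullet> e)" for z
    proof -
      have "U z \<bullet> x = U z \<bullet> U (?r *\<^sub>R e)" by (simp only: U(2))
      also have "\<dots> = z \<bullet> (?r *\<^sub>R e)" using U(1) by (simp only: orthogonal_transformation_def)
      finally show ?thesis by simp
    qed
    then show ?thesis by (simp add: zonal_integral_def mult.assoc)
  qed
  \<comment> \<open>The exponent is split as (n - 1) q = - (n - 1)(q - 1) + (2 (n - 1) q - n + 1),
    whose second summand belongs to \<open>poisson_zonal\<close>.\<close>
  also have "(1 - ?r\<^sup>2) powr ?\<alpha> = (1 - ?r\<^sup>2) powr (- ((real CARD('n) - 1) * (q - 1))) * (1 - ?r\<^sup>2) powr (2 * ?\<alpha> - real CARD('n) + 1)"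
    by (simp add: powr_add[symmetric] algebra_simps)
  finally show ?thesis
    by (simp add: poisson_zonal_def)
qed

text \<open>Equality holds in Hoelder's inequality for \<open>\<phi> = P powr (q - 1)\<close> times a fixed unit vector.\<close>

lemma poisson_szego_extremal:
  fixes x e :: "real ^ 'n" and p :: ennreal
  assumes pq: "1 < p" "1 \<le> q" "1 / p + 1 / ennreal q = 1" and x: "norm x < 1" and e: "norm e = 1"
  defines "\<phi> \<equiv> \<lambda>z. poisson_szego_kernel x z powr (q - 1) *\<^sub>R e"
    and "I \<equiv> \<integral>z. poisson_szego_kernel x z powr q \<partial>sphere_measure"
  shows "\<phi> \<in> Lp_space p sphere_measure"
    and "Lp_norm p sphere_measure \<phi> = I powr enn2real (1 / p)"
    and "norm (poisson_szego \<phi> x) = I"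
proof -
  have [measurable]: "\<phi> \<in> borel_measurable sphere_measure"
    unfolding \<phi>_def by measurable
  have P: "0 < poisson_szego_kernel x z" if "z \<in> space sphere_measure" for z
    using poisson_szego_kernel_pos[OF x] that by (simp add: space_sphere_measure)
  have n\<phi>: "norm (\<phi> z) = poisson_szego_kernel x z powr (q - 1)" for z
    by (simp add: \<phi>_def e)
  have "poisson_szego \<phi> x = (\<integral>z. poisson_szego_kernel x z powr q *\<^sub>R e \<partial>sphere_measure)"
    unfolding poisson_szego_def
  proof (rule Bochner_Integration.integral_cong[OF refl])
    fix z :: "real ^ 'n" assume "z \<in> space sphere_measure"
    from powr_mult_base[OF less_imp_le[OF P[OF this]], of "q - 1"]
    show "poisson_szego_kernel x z *\<^sub>R \<phi> z = poisson_szego_kernel x z powr q *\<^sub>R e"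
      by (simp add: \<phi>_def)
  qed
  also have "\<dots> = I *\<^sub>R e"
    using integrable_poisson_szego_kernel_powr[OF x] by (simp add: I_def)
  finally show "norm (poisson_szego \<phi> x) = I"
    using e by (simp add: I_def)
  have "\<phi> \<in> Lp_space p sphere_measure \<and> Lp_norm p sphere_measure \<phi> = I powr enn2real (1 / p)"
    using pq
  proof (cases rule: conjugate_exponent_cases)
    case 1
    obtain b :: "real ^ 'n" where b: "b \<in> Basis" using nonempty_Basis by blast
    \<comment> \<open>For infinite \<open>p\<close> the claimed norm is \<open>I powr 0\<close>.
      This is 1 only for nonzero \<open>I\<close>, because \<open>0 powr 0 = 0\<close>.\<close>
    have "0 < I"
      unfolding I_def integral_poisson_szego_kernel_powr[OF x b]
      using one_minus_square_pos[of "norm x"] poisson_zonal_pos[OF b, of "norm x"] x by (intro mult_pos_pos) auto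
    have "esssup sphere_measure (\<lambda>z. ennreal (norm (\<phi> z))) = esssup sphere_measure (\<lambda>z :: real ^ 'n. 1)"
      using P 1 by (intro esssup_AE_cong AE_I2) (auto simp: n\<phi> less_imp_neq[symmetric])
    also have "\<dots> = 1"
      by (rule esssup_const) (simp add: space_sphere_measure prob_sphere_measure)
    finally show ?thesis
      using 1 \<open>0 < I\<close> by (simp add: Lp_space_def Lp_norm_def)
  next
    case 2
    \<comment> \<open>Conjugacy makes the p-th power of the norm of \<open>\<phi>\<close> equal to
      the q-th power of the kernel.\<close>
    then have "(q - 1) * enn2real p = q"
      by (simp add: field_simps)
    then have "norm (\<phi> z) powr enn2real p = poisson_szego_kernel x z powr q" for z
      by (simp add: n\<phi> powr_powr)
    then show ?thesis
      using 2 integrable_poisson_szego_kernel_powr[OF x] by (simp add: Lp_space_def Lp_norm_def I_def)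
  qed
  then show "\<phi> \<in> Lp_space p sphere_measure" "Lp_norm p sphere_measure \<phi> = I powr enn2real (1 / p)"
    by auto
qed

theorem theorem1p2:
  fixes p :: ennreal and q :: real
  assumes "CARD('n::finite) \<ge> 3"
    and "1 < p"
    and "1 \<le> q"
    and "1 / p + 1 / ennreal q = 1"
  shows "(\<forall>\<phi> \<in> Lp_space p (sphere_measure :: (real ^ 'n) measure). \<forall>x \<in> ball 0 1.
            norm (poisson_szego \<phi> x)
              \<le> sharp_const CARD('n) q powr (1 / q)
                  / (1 - (norm x)\<^sup>2) powr ((real CARD('n) - 1) * enn2real (1 / p))
                  * Lp_norm p sphere_measure \<phi>)
       \<and> (\<forall>K :: real.
            (\<forall>\<phi> \<in> Lp_space p (sphere_measure :: (real ^ 'n) measure). \<forall>x \<in> ball 0 1.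
               norm (poisson_szego \<phi> x)
                 \<le> K * (1 - (norm x)\<^sup>2) powr (- ((real CARD('n) - 1) * enn2real (1 / p)))
                     * Lp_norm p sphere_measure \<phi>)
            \<longrightarrow> sharp_const CARD('n) q powr (1 / q) \<le> K)"
proof -
  define N where "N = real CARD('n) - 1"
  define s where "s = enn2real (1 / p)"
  define C where "C = sharp_const CARD('n) q"
  define I where "I x = (\<integral>z. poisson_szego_kernel x z powr q \<partial>sphere_measure)" for x :: "real ^ 'n"
  obtain e :: "real ^ 'n" where e: "e \<in> Basis" using nonempty_Basis by blast
  have q: "1 \<le> q" and N: "2 \<le> N" using assms by (simp_all add: N_def)
  \<comment> \<open>One formula for both cases; an infinite \<open>p\<close> gives s = 0 and q =
    1.\<close>
  have s: "s = 1 - 1 / q"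
    using assms(2-4) by (cases rule: conjugate_exponent_cases) (auto simp: s_def)
  have dim: "3 \<le> DIM(real ^ 'n)" and \<alpha>: "real DIM(real ^ 'n) - 1 \<le> N * q"
    using assms q N by (simp_all add: N_def mult_le_cancel_left1)
  \<comment> \<open>With \<alpha> = (n - 1) q the parameters of \<open>sharp_const\<close> become -
    (n - 1)(q - 1) = n - 1 - \<alpha> and n/2 + q - n q = n/2 - \<alpha>.\<close>
  have C: "C = hypergeo_2F1 (real DIM(real ^ 'n) - 1 - N * q) (real DIM(real ^ 'n) / 2 - N * q) (real DIM(real ^ 'n) / 2) 1"
    by (simp add: C_def sharp_const_def N_def algebra_simps)
  let ?\<Psi> = "poisson_zonal e (N * q)"
  \<comment> \<open>Because (q - 1)/q = s, the q-th root produces exactly the power of 1 - |x|^2 in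
    the claim, and only \<open>?\<Psi>\<close> remains to be estimated.\<close>
  have I: "I x powr (1 / q) = (1 - (norm x)\<^sup>2) powr (- (N * s)) * ?\<Psi> (norm x) powr (1 / q)"
    and Ipos: "0 < I x" and \<Psi>pos: "0 < ?\<Psi> (norm x)" and D: "0 < 1 - (norm x)\<^sup>2" if x: "norm x < 1" for x
  proof -
    show D: "0 < 1 - (norm x)\<^sup>2"
      using one_minus_square_pos[of "norm x"] x by simp
    show \<Psi>: "0 < ?\<Psi> (norm x)"
      using poisson_zonal_pos[OF e, of "norm x"] x by simp
    have I: "I x = (1 - (norm x)\<^sup>2) powr (- (N * (q - 1))) * ?\<Psi> (norm x)"
      unfolding I_def N_def by (rule integral_poisson_szego_kernel_powr[OF x e])
    show "0 < I x" unfolding I using D \<Psi> by simp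
    have "- (N * (q - 1)) * (1 / q) = - (N * s)"
      using q by (simp add: s field_simps)
    then show "I x powr (1 / q) = (1 - (norm x)\<^sup>2) powr (- (N * s)) * ?\<Psi> (norm x) powr (1 / q)"
      unfolding I using D \<Psi> by (simp add: powr_mult powr_powr)
  qed
  have upper: "norm (poisson_szego \<phi> x) \<le> C powr (1 / q) / (1 - (norm x)\<^sup>2) powr (N * s) * Lp_norm p sphere_measure \<phi>"
    if \<phi>: "\<phi> \<in> Lp_space p sphere_measure" and x: "x \<in> ball 0 1" for \<phi> :: "real ^ 'n \<Rightarrow> real ^ 'n" and x
  proof -
    have x1: "norm x < 1" using x by simp
    have "norm (poisson_szego \<phi> x) \<le> (\<integral>z. norm (poisson_szego_kernel x z *\<^sub>R \<phi> z) \<partial>sphere_measure)"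
      unfolding poisson_szego_def by (rule integral_norm_bound)
    also have "\<dots> = (\<integral>z. poisson_szego_kernel x z * norm (\<phi> z) \<partial>sphere_measure)"
      using poisson_szego_kernel_nonneg[of x] x1 by simp
    also have "\<dots> \<le> I x powr (1 / q) * Lp_norm p sphere_measure \<phi>"
      unfolding I_def using x1
      by (intro Holder_Lp_norm assms \<phi> integrable_poisson_szego_kernel_powr poisson_szego_kernel_nonneg) auto
    also have "\<dots> \<le> C powr (1 / q) / (1 - (norm x)\<^sup>2) powr (N * s) * Lp_norm p sphere_measure \<phi>"
    proof (rule mult_right_mono)
      have "?\<Psi> (norm x) powr (1 / q) \<le> C powr (1 / q)"
        unfolding C using \<Psi>pos[OF x1] x1 q by (intro powr_mono2 poisson_zonal_le e dim \<alpha>) auto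
      then show "I x powr (1 / q) \<le> C powr (1 / q) / (1 - (norm x)\<^sup>2) powr (N * s)"
        unfolding I[OF x1] using D[OF x1] by (simp add: powr_minus_divide divide_right_mono)
      show "0 \<le> Lp_norm p sphere_measure \<phi>"
        by (simp add: Lp_norm_def)
    qed
    finally show ?thesis .
  qed
  have sharp: "C powr (1 / q) \<le> K"
    if K: "\<And>\<phi> x. \<phi> \<in> Lp_space p (sphere_measure :: (real ^ 'n) measure) \<Longrightarrow> x \<in> ball 0 1 \<Longrightarrow>
      norm (poisson_szego \<phi> x) \<le> K * (1 - (norm x)\<^sup>2) powr (- (N * s)) * Lp_norm p sphere_measure \<phi>" for K
  proof (rule tendsto_upperbound)
    show "((\<lambda>r. ?\<Psi> r powr (1 / q)) \<longlongrightarrow> C powr (1 / q)) (at_left 1)"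
    proof (rule tendsto_powr)
      show "(?\<Psi> \<longlongrightarrow> C) (at_left 1)"
        unfolding C by (rule tendsto_poisson_zonal[OF e dim \<alpha>])
      \<comment> \<open>The limit rule for powers asks for a nonzero base; here C is at least
        \<Psi>(0) = 1.\<close>
      have "?\<Psi> 0 \<le> C"
        unfolding C by (rule poisson_zonal_le[OF e dim \<alpha>]) auto
      then show "C \<noteq> 0" by (simp add: poisson_zonal_0)
    qed simp
    show "\<forall>\<^sub>F r in at_left 1. ?\<Psi> r powr (1 / q) \<le> K"
      using eventually_at_left_real[of 0 1, simplified]
    proof eventually_elim
      case (elim r)
      \<comment> \<open>The constant \<open>K\<close> is tested at the point r e with the extremal
        function belonging to that point. Since 1/q + s = 1, the factor \<open>I x powr s\<close>
        cancels, which leaves \<Psi>(r)^(1/q) \<le> K.\<close>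
      define x where "x = r *\<^sub>R e"
      have nx: "norm x = r" and x: "norm x < 1" "x \<in> ball 0 1"
        using e elim by (simp_all add: x_def)
      have ne: "norm e = 1" using e by simp
      note ext = poisson_szego_extremal[OF assms(2-4) x(1) ne, folded I_def s_def]
      have "I x \<le> K * (1 - (norm x)\<^sup>2) powr (- (N * s)) * I x powr s"
        using K[OF ext(1) x(2)] unfolding ext(2,3) .
      then have "I x powr (1 / q) * I x powr s \<le> K * (1 - (norm x)\<^sup>2) powr (- (N * s)) * I x powr s"
        using Ipos[OF x(1)] by (simp add: s powr_add[symmetric])
      then have "I x powr (1 / q) \<le> K * (1 - (norm x)\<^sup>2) powr (- (N * s))"
        using Ipos[OF x(1)] by (subst (asm) mult_le_cancel_right_pos) auto
      then have "(1 - (norm x)\<^sup>2) powr (- (N * s)) * ?\<Psi> (norm x) powr (1 / q) \<le> (1 - (norm x)\<^sup>2) powr (- (N * s)) * K"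
        unfolding I[OF x(1)] by (simp only: mult.commute)
      then have "?\<Psi> (norm x) powr (1 / q) \<le> K"
        by (rule mult_left_le_imp_le) (use D[OF x(1)] in simp)
      then show ?case by (simp only: nx)
    qed
  qed simp
  show ?thesis
    using upper sharp unfolding C_def N_def s_def by blast
qed

end
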